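(* Let $p,p'$ be relatively prime integers greater than $1$, let $a',b,b'$ be positive integers and let $c$ be a non-negative odd integer such that $a'>c$, $2b$ divides $p$, and $a'b'$ divides $p'$. Put $a=2$, $B=bb'$ and $n=\dfrac{pp'}{2a'bb'}$. Let $\mathcal A_1^{(2)}$ be the set of pairs of integers $(r,s)$ with $0<r<p/b$, $0<s<p'/b'$ and $\dfrac{p'r/b'-ps/b+c}{4a'}\in\mathbb Z$, and let $\mathcal A_2^{(2)}$ be the set of pairs of integers $(r,s)$ with $0<r<p/b$, $0<s<p'/b'$ and $\dfrac{p'r/b'+ps/b-c}{4a'}\in\mathbb Z$. Then the following identity of formal power series in $q$ holds: $$\frac{(q^{\frac{B(a'-c)}{2}},q^{\frac{B(a'+c)}{2}},q^{Ba'};q^{Ba'})_\infty}{(q^n;q^n)_\infty}=q^{\frac{(p-p')^2-(cB)^2}{8Ba'}}\Big(\sum_{(r,s)\in\mathcal A_1^{(2)}}\chi_{rb,sb'}^{(p,p')}(q^n)-\sum_{(r,s)\in\mathcal A_2^{(2)}}\chi_{rb,sb'}^{(p,p')}(q^n)\Big).$$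
   Context: Notation: $(u_1,\dots,u_k;v)_\infty:=\prod_{i=0}^\infty\prod_{j=1}^k(1-u_jv^i)$ and $(q)_\infty=\prod_{j=1}^\infty(1-q^j)$. For relatively prime integers $p,p'>1$ and integers $1\le r\le p-1$, $1\le s\le p'-1$, $\chi_{r,s}^{(p,p')}(q)$ denotes the formal character $\mathrm{Tr}(q^{L_0})$ of the irreducible Virasoro module $M^{(p,p')}_{r,s}$ of the $(p,p')$ minimal series; it is given (Rocha-Caridi formula) by $$\chi_{r,s}^{(p,p')}(q)=\frac{q^{-\frac{(p'-p)^2}{4pp'}}}{(q)_\infty}\left(\sum_{j\in\mathbb Z}q^{\frac{(2pp'j+p'r-ps)^2}{4pp'}}-\sum_{j\in\mathbb Z}q^{\frac{(2pp'j+p'r+ps)^2}{4pp'}}\right),$$ which may be taken as its definition. It is a formal series in rational powers of $q$; $\chi(q^n)$ means that every exponent is multiplied by $n$. *)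

theory Defs
  imports
    "HOL-Analysis.Infinite_Products"
    "HOL-Computational_Algebra.Formal_Power_Series"
begin

section \<open>Formal series in rational powers of $q$\<close>

text \<open>
  Series $\sum_e c_e q^e$ over rational exponents such that only finitely many exponents below any
  given bound carry a nonzero coefficient. This is the condition under which the Cauchy product is
  a finite sum in each degree.
\<close>

definition left_finite :: "(rat \<Rightarrow> 'a::zero) \<Rightarrow> bool" where
  "left_finite f \<longleftrightarrow> (\<forall>x. finite {e. e \<le> x \<and> f e \<noteq> 0})"

typedef (overloaded) 'a qseries = "{f :: rat \<Rightarrow> 'a::zero. left_finite f}"
  morphisms qcoeff Abs_qseries
  by (rule exI[of _ "\<lambda>_. 0"]) (simp add: left_finite_def)

setup_lifting type_definition_qseries

lemma qseries_eqI: "(\<And>e. qcoeff f e = qcoeff g e) \<Longrightarrow> f = g"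
  by transfer auto

lemma left_finite_subset:
  assumes "left_finite f" "\<And>e. g e \<noteq> 0 \<Longrightarrow> f e \<noteq> 0"
  shows "left_finite g"
  unfolding left_finite_def
proof
  fix x
  show "finite {e. e \<le> x \<and> g e \<noteq> 0}"
    by (rule finite_subset[of _ "{e. e \<le> x \<and> f e \<noteq> 0}"])
       (use assms in \<open>auto simp: left_finite_def\<close>)
qed

lemma left_finite_subset2:
  assumes "left_finite f" "left_finite g" "\<And>e. h e \<noteq> 0 \<Longrightarrow> f e \<noteq> 0 \<or> g e \<noteq> 0"
  shows "left_finite h"
  unfolding left_finite_def
proof
  fix x
  show "finite {e. e \<le> x \<and> h e \<noteq> 0}"
    by (rule finite_subset[of _ "{e. e \<le> x \<and> f e \<noteq> 0} \<union> {e. e \<le> x \<and> g e \<noteq> 0}"])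
       (use assms in \<open>auto simp: left_finite_def\<close>)
qed

lemma left_finite_lower_bound:
  assumes "left_finite f"
  obtains l where "\<And>e. f e \<noteq> 0 \<Longrightarrow> l \<le> e"
proof -
  let ?S = "{e. e \<le> 0 \<and> f e \<noteq> 0}"
  have fin: "finite ?S" using assms by (simp add: left_finite_def)
  have "Min (insert 0 ?S) \<le> e" if "f e \<noteq> 0" for e
  proof (cases "e \<le> 0")
    case True
    then show ?thesis using that fin by (intro Min_le) auto
  next
    case False
    have "Min (insert 0 ?S) \<le> 0" using fin by (intro Min_le) auto
    then show ?thesis using False by linarith
  qed
  then show ?thesis using that by blast
qed

definition qconv :: "(rat \<Rightarrow> 'a::semiring_0) \<Rightarrow> (rat \<Rightarrow> 'a) \<Rightarrow> rat \<Rightarrow> 'a" where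
  "qconv f g e = (\<Sum>x | f x \<noteq> 0 \<and> g (e - x) \<noteq> 0. f x * g (e - x))"

lemma finite_qconv_support:
  assumes "left_finite f" "left_finite g"
  shows "finite {x. f x \<noteq> 0 \<and> g (e - x) \<noteq> 0}"
proof -
  obtain l where l: "\<And>e. g e \<noteq> 0 \<Longrightarrow> l \<le> e" using left_finite_lower_bound assms(2) by blast
  have "x \<le> e - l" if "g (e - x) \<noteq> 0" for x using l[OF that] by linarith
  then have "{x. f x \<noteq> 0 \<and> g (e - x) \<noteq> 0} \<subseteq> {x. x \<le> e - l \<and> f x \<noteq> 0}" by auto
  then show ?thesis using assms(1) finite_subset unfolding left_finite_def by blast
qed

lemma qconv_eq_sum:
  assumes "finite F" "\<And>x. f x \<noteq> 0 \<Longrightarrow> g (e - x) \<noteq> 0 \<Longrightarrow> x \<in> F"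
  shows "qconv f g e = (\<Sum>x\<in>F. f x * g (e - x))"
  unfolding qconv_def by (rule sum.mono_neutral_left) (use assms in auto)

lemma qconv_nonzeroE:
  assumes "qconv f g e \<noteq> 0"
  obtains x where "f x \<noteq> 0" "g (e - x) \<noteq> 0"
  using assms unfolding qconv_def by (auto elim: sum.not_neutral_contains_not_neutral)

lemma left_finite_qconv:
  assumes "left_finite f" "left_finite g"
  shows "left_finite (qconv f g)"
  unfolding left_finite_def
proof
  fix x
  obtain lf where lf: "\<And>e. f e \<noteq> 0 \<Longrightarrow> lf \<le> e" using left_finite_lower_bound assms(1) by blast
  obtain lg where lg: "\<And>e. g e \<noteq> 0 \<Longrightarrow> lg \<le> e" using left_finite_lower_bound assms(2) by blast
  let ?F = "{u. u \<le> x - lg \<and> f u \<noteq> 0}" and ?G = "{v. v \<le> x - lf \<and> g v \<noteq> 0}"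
  have "{e. e \<le> x \<and> qconv f g e \<noteq> 0} \<subseteq> (\<lambda>(u, v). u + v) ` (?F \<times> ?G)"
  proof
    fix e assume "e \<in> {e. e \<le> x \<and> qconv f g e \<noteq> 0}"
    then have ex: "e \<le> x" and nz: "qconv f g e \<noteq> 0" by auto
    from nz obtain u where u: "f u \<noteq> 0" "g (e - u) \<noteq> 0"
      by (rule qconv_nonzeroE)
    have "u \<in> ?F" "e - u \<in> ?G" using u lf[OF u(1)] lg[OF u(2)] ex by auto
    then show "e \<in> (\<lambda>(u, v). u + v) ` (?F \<times> ?G)"
      by (intro image_eqI[of _ _ "(u, e - u)"]) auto
  qed
  moreover have "finite (?F \<times> ?G)" using assms by (simp add: left_finite_def)
  ultimately show "finite {e. e \<le> x \<and> qconv f g e \<noteq> 0}"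
    using finite_subset by blast
qed

lemma qconv_commute:
  fixes f g :: "rat \<Rightarrow> 'a::comm_semiring_0"
  shows "qconv f g = qconv g f"
proof
  fix e
  show "qconv f g e = qconv g f e"
    unfolding qconv_def
    by (rule sum.reindex_bij_witness[of _ "\<lambda>x. e - x" "\<lambda>x. e - x"]) (auto simp: mult.commute)
qed

lemma qconv_assoc:
  fixes f g h :: "rat \<Rightarrow> 'a::comm_semiring_0"
  assumes f: "left_finite f" and g: "left_finite g" and h: "left_finite h"
  shows "qconv (qconv f g) h = qconv f (qconv g h)"
proof
  fix e
  obtain lf where lf: "\<And>e. f e \<noteq> 0 \<Longrightarrow> lf \<le> e" using left_finite_lower_bound f by blast
  obtain lg where lg: "\<And>e. g e \<noteq> 0 \<Longrightarrow> lg \<le> e" using left_finite_lower_bound g by blast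
  obtain lh where lh: "\<And>e. h e \<noteq> 0 \<Longrightarrow> lh \<le> e" using left_finite_lower_bound h by blast
  define F where "F = {x. x \<le> e - lg - lh \<and> f x \<noteq> 0}"
  define H where "H = {x. x \<le> e - lf - lg \<and> h x \<noteq> 0}"
  have fin: "finite F" "finite H"
    using f h by (simp_all add: F_def H_def left_finite_def)
  have lfg: "lf + lg \<le> x" if "qconv f g x \<noteq> 0" for x
  proof -
    obtain u where u: "f u \<noteq> 0" "g (x - u) \<noteq> 0"
      using \<open>qconv f g x \<noteq> 0\<close> by (rule qconv_nonzeroE)
    then show ?thesis using lf[OF u(1)] lg[OF u(2)] by linarith
  qed
  have lgh: "lg + lh \<le> x" if "qconv g h x \<noteq> 0" for x
  proof -
    obtain u where u: "g u \<noteq> 0" "h (x - u) \<noteq> 0"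
      using \<open>qconv g h x \<noteq> 0\<close> by (rule qconv_nonzeroE)
    then show ?thesis using lg[OF u(1)] lh[OF u(2)] by linarith
  qed
  have 1: "qconv f g (e - z) * h z = (\<Sum>x\<in>F. f x * g (e - z - x) * h z)" for z
  proof (cases "h z = 0")
    case False
    have "qconv f g (e - z) = (\<Sum>x\<in>F. f x * g (e - z - x))"
    proof (rule qconv_eq_sum[OF fin(1)])
      fix x assume "f x \<noteq> 0" "g (e - z - x) \<noteq> 0"
      then show "x \<in> F" using lg[of "e - z - x"] lh[OF False] by (simp add: F_def)
    qed
    then show ?thesis by (simp add: sum_distrib_right)
  qed auto
  have 2: "f x * qconv g h (e - x) = (\<Sum>z\<in>H. f x * g (e - z - x) * h z)" for x
  proof (cases "f x = 0")
    case False
    have "qconv h g (e - x) = (\<Sum>z\<in>H. h z * g (e - x - z))"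
    proof (rule qconv_eq_sum[OF fin(2)])
      fix z assume "h z \<noteq> 0" "g (e - x - z) \<noteq> 0"
      then show "z \<in> H" using lg[of "e - x - z"] lf[OF False] by (simp add: H_def)
    qed
    moreover have "e - x - z = e - z - x" for z by simp
    ultimately show ?thesis
      by (simp add: qconv_commute[of g h] sum_distrib_left mult_ac)
  qed auto
  have "qconv (qconv f g) h e = qconv h (qconv f g) e"
    by (simp add: qconv_commute[of h])
  also have "\<dots> = (\<Sum>z\<in>H. h z * qconv f g (e - z))"
  proof (rule qconv_eq_sum[OF fin(2)])
    fix z assume "h z \<noteq> 0" "qconv f g (e - z) \<noteq> 0"
    then show "z \<in> H" using lfg[of "e - z"] by (simp add: H_def)
  qed
  also have "\<dots> = (\<Sum>z\<in>H. \<Sum>x\<in>F. f x * g (e - z - x) * h z)"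
    by (simp add: 1 mult.commute[of "h _"])
  also have "\<dots> = (\<Sum>x\<in>F. \<Sum>z\<in>H. f x * g (e - z - x) * h z)"
    by (rule sum.swap)
  also have "\<dots> = (\<Sum>x\<in>F. f x * qconv g h (e - x))" by (simp only: 2)
  also have "\<dots> = qconv f (qconv g h) e"
  proof (rule qconv_eq_sum[OF fin(1), symmetric])
    fix x assume "f x \<noteq> 0" "qconv g h (e - x) \<noteq> 0"
    then show "x \<in> F" using lgh[of "e - x"] by (simp add: F_def algebra_simps)
  qed
  finally show "qconv (qconv f g) h e = qconv f (qconv g h) e" .
qed

instantiation qseries :: (comm_ring_1) comm_ring_1
begin

lift_definition zero_qseries :: "'a qseries" is "\<lambda>_. 0"
  by (simp add: left_finite_def)

lift_definition one_qseries :: "'a qseries" is "\<lambda>e. if e = 0 then 1 else 0"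
  by (auto simp: left_finite_def intro: finite_subset[of _ "{0}"])

lift_definition plus_qseries :: "'a qseries \<Rightarrow> 'a qseries \<Rightarrow> 'a qseries" is "\<lambda>f g e. f e + g e"
  by (erule left_finite_subset2) auto

lift_definition minus_qseries :: "'a qseries \<Rightarrow> 'a qseries \<Rightarrow> 'a qseries" is "\<lambda>f g e. f e - g e"
  by (erule left_finite_subset2) auto

lift_definition uminus_qseries :: "'a qseries \<Rightarrow> 'a qseries" is "\<lambda>f e. - f e"
  by (erule left_finite_subset) auto

lift_definition times_qseries :: "'a qseries \<Rightarrow> 'a qseries \<Rightarrow> 'a qseries" is qconv
  by (rule left_finite_qconv)

instance
proof
  fix a b c :: "'a qseries"
  show "a * b * c = a * (b * c)" by transfer (rule qconv_assoc)
  show "a * b = b * a" by transfer (rule qconv_commute)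
  show "1 * a = a"
  proof (transfer, rule ext)
    fix f :: "rat \<Rightarrow> 'a" and e
    show "qconv (\<lambda>e. if e = 0 then 1 else 0) f e = f e"
      by (subst qconv_eq_sum[of "{0}"]) (auto split: if_splits)
  qed
  show "(a + b) * c = a * c + b * c"
  proof (transfer, rule ext)
    fix f g h :: "rat \<Rightarrow> 'a" and e
    assume *: "left_finite f" "left_finite g" "left_finite h"
    let ?F = "{x. f x \<noteq> 0 \<and> h (e - x) \<noteq> 0} \<union> {x. g x \<noteq> 0 \<and> h (e - x) \<noteq> 0}"
    have fin: "finite ?F" using * by (simp add: finite_qconv_support)
    have "qconv (\<lambda>e. f e + g e) h e = (\<Sum>x\<in>?F. (f x + g x) * h (e - x))"
      by (rule qconv_eq_sum[OF fin]) auto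
    moreover have "qconv f h e = (\<Sum>x\<in>?F. f x * h (e - x))"
      by (rule qconv_eq_sum[OF fin]) auto
    moreover have "qconv g h e = (\<Sum>x\<in>?F. g x * h (e - x))"
      by (rule qconv_eq_sum[OF fin]) auto
    ultimately show "qconv (\<lambda>e. f e + g e) h e = qconv f h e + qconv g h e"
      by (simp add: ring_distribs sum.distrib)
  qed
  show "(0 :: 'a qseries) \<noteq> 1" by transfer (auto dest: fun_cong[of _ _ 0])
qed (transfer; simp add: fun_eq_iff algebra_simps)+

end

lift_definition qpow :: "rat \<Rightarrow> 'a::comm_ring_1 qseries" is "\<lambda>x e. if e = x then 1 else 0"
proof -
  fix x :: rat
  show "left_finite (\<lambda>e. if e = x then 1 else 0 :: 'a)"
    by (auto simp: left_finite_def intro: finite_subset[of _ "{x}"])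
qed

lemma qpow_0: "qpow 0 = 1"
  by transfer simp

lemma qcoeff_qpow_mult: "qcoeff (qpow x * f) e = qcoeff f (e - x)"
proof (transfer, goal_cases)
  case (1 x f e)
  show ?case by (subst qconv_eq_sum[of "{x}"]) (auto split: if_splits)
qed

lemma qpow_add: "qpow (x + y) = qpow x * qpow y"
  by (rule qseries_eqI) (auto simp: qcoeff_qpow_mult qpow.rep_eq)

lift_definition qseries_of_fps :: "'a::comm_ring_1 fps \<Rightarrow> 'a qseries" is
  "\<lambda>f e. if e \<in> \<nat> then fps_nth f (nat \<lfloor>e\<rfloor>) else 0"
proof -
  fix f :: "'a fps"
  show "left_finite (\<lambda>e. if e \<in> \<nat> then fps_nth f (nat \<lfloor>e\<rfloor>) else 0)"
    unfolding left_finite_def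
  proof
    fix x :: rat
    have "{e. e \<le> x \<and> (if e \<in> \<nat> then fps_nth f (nat \<lfloor>e\<rfloor>) else 0) \<noteq> 0}
            \<subseteq> of_nat ` {..nat \<lfloor>x\<rfloor>}"
      by (auto elim!: Nats_cases simp: le_nat_iff le_floor_iff)
    then show "finite {e. e \<le> x \<and> (if e \<in> \<nat> then fps_nth f (nat \<lfloor>e\<rfloor>) else 0) \<noteq> 0}"
      by (rule finite_subset) auto
  qed
qed

lemma qcoeff_qseries_of_fps_of_nat: "qcoeff (qseries_of_fps f) (of_nat k) = fps_nth f k"
  by transfer simp

lemma qcoeff_qseries_of_fps_eq_0: "e \<notin> \<nat> \<Longrightarrow> qcoeff (qseries_of_fps f) e = 0"
  by transfer simp

lemma qseries_of_fps_X_power: "qseries_of_fps (fps_X ^ k) = qpow (of_nat k)"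
proof (rule qseries_eqI)
  fix e
  show "qcoeff (qseries_of_fps (fps_X ^ k)) e = (qcoeff (qpow (of_nat k)) e :: 'a)"
    by (cases "e \<in> \<nat>")
       (auto elim!: Nats_cases simp: qcoeff_qseries_of_fps_of_nat qcoeff_qseries_of_fps_eq_0
          qpow.rep_eq fps_X_power_nth)
qed

lemma qseries_of_fps_mult: "qseries_of_fps (f * g) = qseries_of_fps f * qseries_of_fps g"
proof (rule qseries_eqI)
  fix e
  let ?f = "qcoeff (qseries_of_fps f)" and ?g = "qcoeff (qseries_of_fps g)"
  note [simp] = qcoeff_qseries_of_fps_of_nat
  have zf: "x \<in> \<nat>" if "?f x \<noteq> 0" for x
    using that qcoeff_qseries_of_fps_eq_0 by blast
  have zg: "x \<in> \<nat>" if "?g x \<noteq> 0" for x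
    using that qcoeff_qseries_of_fps_eq_0 by blast
  show "qcoeff (qseries_of_fps (f * g)) e = qcoeff (qseries_of_fps f * qseries_of_fps g) e"
  proof (cases "e \<in> \<nat>")
    case True
    then obtain k where k: "e = of_nat k" by (auto elim: Nats_cases)
    have "qconv ?f ?g e = (\<Sum>x\<in>of_nat ` {0..k}. ?f x * ?g (e - x))"
    proof (rule qconv_eq_sum)
      fix x assume "?f x \<noteq> 0" "?g (e - x) \<noteq> 0"
      then obtain i j where "x = of_nat i" "e - x = of_nat j"
        using zf zg by (meson Nats_cases)
      moreover from this have "k = i + j"
        using k by (metis add_diff_cancel_left' diff_add_cancel of_nat_add of_nat_eq_iff add.commute)
      ultimately show "x \<in> of_nat ` {0..k}" by auto
    qed auto
    also have "\<dots> = (\<Sum>i=0..k. fps_nth f i * fps_nth g (k - i))"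
      by (subst sum.reindex) (auto simp: inj_on_def k simp flip: of_nat_diff intro!: sum.cong)
    finally show ?thesis by (simp add: times_qseries.rep_eq k fps_mult_nth)
  next
    case False
    have "?f x = 0 \<or> ?g (e - x) = 0" for x
      using zf[of x] zg[of "e - x"] False Nats_add[of x "e - x"] by auto
    then have "qconv ?f ?g e = 0" unfolding qconv_def by (intro sum.neutral) auto
    then show ?thesis using False by (simp add: times_qseries.rep_eq qcoeff_qseries_of_fps_eq_0)
  qed
qed

text \<open>The substitution $q \mapsto q^n$, meaningful for $n > 0$ only.\<close>

lift_definition qdilate :: "nat \<Rightarrow> 'a::comm_ring_1 qseries \<Rightarrow> 'a qseries" is
  "\<lambda>n f e. if n = 0 then 0 else f (e / of_nat n)"
proof -
  fix n and f :: "rat \<Rightarrow> 'a"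
  assume f: "left_finite f"
  show "left_finite (\<lambda>e. if n = 0 then 0 else f (e / of_nat n))"
    unfolding left_finite_def
  proof
    fix x
    have "{e. e \<le> x \<and> (if n = 0 then 0 else f (e / of_nat n)) \<noteq> 0}
            \<subseteq> (\<lambda>e. e * of_nat n) ` {e. e \<le> x / of_nat n \<and> f e \<noteq> 0}"
      by (auto split: if_splits simp: divide_right_mono intro!: image_eqI[of _ _ "_ / of_nat n"])
    then show "finite {e. e \<le> x \<and> (if n = 0 then 0 else f (e / of_nat n)) \<noteq> 0}"
      using f finite_subset unfolding left_finite_def by blast
  qed
qed

lemma qdilate_qpow: "n > 0 \<Longrightarrow> qdilate n (qpow x) = qpow (of_nat n * x)"
  by (rule qseries_eqI) (auto simp: qdilate.rep_eq qpow.rep_eq field_simps)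

text \<open>
  Sums of families of series, taken coefficientwise. The value is meaningful for families in which
  only finitely many members have a nonzero coefficient below any given exponent.
\<close>

definition qsummable :: "('i \<Rightarrow> 'a::comm_ring_1 qseries) \<Rightarrow> bool" where
  "qsummable F \<longleftrightarrow> (\<forall>x. finite {j. \<exists>e\<le>x. qcoeff (F j) e \<noteq> 0})"

definition qsum :: "('i \<Rightarrow> 'a::comm_ring_1 qseries) \<Rightarrow> 'a qseries" where
  "qsum F = Abs_qseries (\<lambda>e. \<Sum>j | qcoeff (F j) e \<noteq> 0. qcoeff (F j) e)"

lemma qcoeff_qsum:
  assumes "qsummable F"
  shows "qcoeff (qsum F) e = (\<Sum>j | qcoeff (F j) e \<noteq> 0. qcoeff (F j) e)"
proof -
  have "left_finite (\<lambda>e. \<Sum>j | qcoeff (F j) e \<noteq> 0. qcoeff (F j) e)"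
    unfolding left_finite_def
  proof
    fix x
    let ?J = "{j. \<exists>e\<le>x. qcoeff (F j) e \<noteq> 0}"
    have "{e. e \<le> x \<and> (\<Sum>j | qcoeff (F j) e \<noteq> 0. qcoeff (F j) e) \<noteq> 0}
            \<subseteq> (\<Union>j\<in>?J. {e. e \<le> x \<and> qcoeff (F j) e \<noteq> 0})"
    proof safe
      fix e assume "e \<le> x" "(\<Sum>j | qcoeff (F j) e \<noteq> 0. qcoeff (F j) e) \<noteq> 0"
      moreover from this obtain j where "qcoeff (F j) e \<noteq> 0"
        by (auto elim: sum.not_neutral_contains_not_neutral)
      ultimately show "e \<in> (\<Union>j\<in>?J. {e. e \<le> x \<and> qcoeff (F j) e \<noteq> 0})" by auto
    qed
    moreover have "finite (\<Union>j\<in>?J. {e. e \<le> x \<and> qcoeff (F j) e \<noteq> 0})"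
      using assms qcoeff unfolding qsummable_def left_finite_def by (intro finite_UN_I) auto
    ultimately show "finite {e. e \<le> x \<and> (\<Sum>j | qcoeff (F j) e \<noteq> 0. qcoeff (F j) e) \<noteq> 0}"
      by (rule finite_subset)
  qed
  then show ?thesis by (simp add: qsum_def Abs_qseries_inverse)
qed

lemma qsummable_theta:
  assumes "k \<noteq> 0" "d > 0"
  shows "qsummable (\<lambda>j::int. qpow (of_int ((k * j + m)\<^sup>2) / of_nat d) :: 'a::comm_ring_1 qseries)"
  unfolding qsummable_def
proof
  fix x :: rat
  define N where "N = \<bar>\<lfloor>x * of_nat d\<rfloor>\<bar>"
  have "{j. \<exists>e\<le>x. qcoeff (qpow (of_int ((k * j + m)\<^sup>2) / of_nat d) :: 'a qseries) e \<noteq> 0}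
          \<subseteq> {j. k * j + m \<in> {-N..N}}"
  proof safe
    fix j e
    assume "e \<le> x" "qcoeff (qpow (of_int ((k * j + m)\<^sup>2) / of_nat d) :: 'a qseries) e \<noteq> 0"
    then have "(of_int ((k * j + m)\<^sup>2) :: rat) / of_nat d \<le> x"
      by (simp add: qpow.rep_eq split: if_splits)
    then have "(of_int ((k * j + m)\<^sup>2) :: rat) \<le> x * of_nat d"
      using assms(2) by (simp only: pos_divide_le_eq of_nat_0_less_iff)
    then have "(k * j + m)\<^sup>2 \<le> N" unfolding N_def by linarith
    moreover have "\<bar>k * j + m\<bar> \<le> (k * j + m)\<^sup>2"
      using self_le_power[of "\<bar>k * j + m\<bar>" 2] by (cases "k * j + m = 0") auto
    ultimately show "k * j + m \<in> {-N..N}" by auto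
  qed
  moreover have "finite {j. k * j + m \<in> {-N..N}}"
    using finite_vimageI[of "{-N..N}" "\<lambda>j. k * j + m"] assms(1)
    by (simp add: vimage_def inj_def)
  ultimately show "finite {j. \<exists>e\<le>x. qcoeff (qpow (of_int ((k * j + m)\<^sup>2) / of_nat d) :: 'a qseries) e \<noteq> 0}"
    by (rule finite_subset)
qed


section \<open>Infinite products and minimal series characters\<close>

text \<open>$(u_1,\dots,u_k;v)_\infty$, the infinite product being the limit in the $q$-adic topology.\<close>

definition qpochhammer_inf :: "'a::field fps list \<Rightarrow> 'a fps \<Rightarrow> 'a fps" where
  "qpochhammer_inf us v = (\<Prod>i. \<Prod>u\<leftarrow>us. 1 - u * v ^ i)"

definition virasoro_char :: "nat \<Rightarrow> nat \<Rightarrow> int \<Rightarrow> int \<Rightarrow> complex qseries" where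
  "virasoro_char p p' r s =
     qpow (- of_int ((int p' - int p)\<^sup>2) / of_nat (4 * p * p'))
     * qseries_of_fps (1 / qpochhammer_inf [fps_X] fps_X)
     * (qsum (\<lambda>j::int. qpow (of_int ((2 * int p * int p' * j + int p' * r - int p * s)\<^sup>2)
                               / of_nat (4 * p * p')))
        - qsum (\<lambda>j::int. qpow (of_int ((2 * int p * int p' * j + int p' * r + int p * s)\<^sup>2)
                                 / of_nat (4 * p * p'))))"

definition index_set1 :: "nat \<Rightarrow> nat \<Rightarrow> nat \<Rightarrow> nat \<Rightarrow> nat \<Rightarrow> nat \<Rightarrow> (int \<times> int) set" where
  "index_set1 p p' a' b b' c =
     {(r, s). 0 < r \<and> rat_of_int r < of_nat p / of_nat b \<and>
              0 < s \<and> rat_of_int s < of_nat p' / of_nat b' \<and>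
              (of_nat p' * of_int r / of_nat b' - of_nat p * of_int s / of_nat b + of_nat c)
                / (4 * of_nat a') \<in> (\<int> :: rat set)}"

definition index_set2 :: "nat \<Rightarrow> nat \<Rightarrow> nat \<Rightarrow> nat \<Rightarrow> nat \<Rightarrow> nat \<Rightarrow> (int \<times> int) set" where
  "index_set2 p p' a' b b' c =
     {(r, s). 0 < r \<and> rat_of_int r < of_nat p / of_nat b \<and>
              0 < s \<and> rat_of_int s < of_nat p' / of_nat b' \<and>
              (of_nat p' * of_int r / of_nat b' + of_nat p * of_int s / of_nat b - of_nat c)
                / (4 * of_nat a') \<in> (\<int> :: rat set)}"

lemma finite_index_box:
  "finite {(r :: int, s :: int). 0 < r \<and> rat_of_int r < x \<and> 0 < s \<and> rat_of_int s < y}"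
  by (rule finite_subset[of _ "{0..\<lceil>x\<rceil>} \<times> {0..\<lceil>y\<rceil>}"]) (auto, linarith+)

lemma finite_index_set1: "finite (index_set1 p p' a' b b' c)"
  unfolding index_set1_def by (rule finite_subset[OF _ finite_index_box]) auto

lemma finite_index_set2: "finite (index_set2 p p' a' b b' c)"
  unfolding index_set2_def by (rule finite_subset[OF _ finite_index_box]) auto

text \<open>The integer divisions by which exponents are formed below are exact.\<close>

lemma exact_divisions:
  fixes p p' a' b b' c :: nat
  assumes "coprime p p'" "p > 1" "p' > 1" "a' > 0" "b > 0" "b' > 0" "odd c" "c < a'"
    and "2 * b dvd p" "a' * b' dvd p'"
  shows "2 * a' * b * b' dvd p * p'" "0 < p * p' div (2 * a' * b * b')"
    and "2 dvd B * (a' - c)" "2 dvd B * (a' + c)"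
proof -
  show d: "2 * a' * b * b' dvd p * p'"
    using mult_dvd_mono[OF assms(9,10)] by (simp add: mult_ac)
  show "0 < p * p' div (2 * a' * b * b')"
    using d assms by (simp add: dvd_imp_le div_greater_zero_iff)
  have "even p" using assms(9) by (meson dvd_mult_left)
  then have "odd p'" using assms(1) by auto
  then have "odd a'" using assms(10) by (meson dvd_mult_left dvd_trans)
  then show "2 dvd B * (a' - c)" "2 dvd B * (a' + c)" using assms by auto
qed

end

theory Submission
  imports Defs "HOL-Computational_Algebra.Formal_Laurent_Series"
begin

text \<open>
  After multiplication by $(q^n;q^n)_\infty$ both sides are signed sums of powers $q^{Bx^2/(8a')}$ over
  integers $x$, up to the common factor $q^{-h}$ with $h = Bc^2/(8a')$.

  On the product side this is the Jacobi triple product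
  \[ (q^\alpha, q^\beta, q^{\alpha+\beta}; q^{\alpha+\beta})_\infty
       = \sum_{k \in \mathbb{Z}} (-1)^k q^{\alpha k(k-1)/2 + \beta k(k+1)/2} \]
  with $\alpha = B(a'-c)/2$ and $\beta = B(a'+c)/2$: completing the square turns the exponent
  into $B(2a'k+c)^2/(8a') - h$. The triple product is \<open>jacobi_triple_product_fps\<close>. It is obtained from
  a finite version, a case of the $q$-binomial theorem, by comparing coefficients modulo powers of $X$.

  On the character side put $N = p/b$ and $M = p'/b'$. The factor $1/(q)_\infty$ of each character
  becomes $1/(q^n;q^n)_\infty$, and $n/(4pp') = 1/(8a'B)$, so that the two theta series of the character
  with labels $(rb, sb')$ run over $x = 2NMj + (Mr - Ns)$ and $x = 2NMj + (Mr + Ns)$.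

  It remains to see that these progressions, for $(r,s)$ in the two index sets, exhaust the numbers
  $x = 2a'k + c$ without repetition and with the sign $(-1)^k$. By the Chinese remainder theorem every
  $x$ that is a multiple neither of $N$ nor of $M$ is $2NMj + (\sigma Mr + Ns)$ for exactly one choice of
  $j$, of the sign $\sigma$, and of $0 < r < N$, $0 < s < M$. The even $k$ belong to
  $x \equiv c$ modulo $4a'$ and the odd $k$ to $x \equiv c + 2a'$, and the
  defining congruences of the index sets say which pairs $(r,s)$ occur in which class. The sign
  $\sigma = -1$ is harmless because $x$ enters only through its square. This is the lemma
  \<open>signed_theta_regrouping\<close>.
\<close>

section \<open>Infinite products of power series modulo powers of $X$\<close>

text \<open>
  Limits of power series are handled through congruences modulo powers of $X$: two series are
  compared by divisibility of their difference by $X^n$, so that all estimates become ring algebra.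
\<close>

lemma fps_X_power_dvd_iff:
  "fps_X ^ n dvd (f :: 'a::comm_ring_1 fps) \<longleftrightarrow> (\<forall>k<n. fps_nth f k = 0)"
proof
  assume "fps_X ^ n dvd f"
  then show "\<forall>k<n. fps_nth f k = 0"
    by (auto elim!: dvdE simp: fps_X_power_mult_nth)
next
  assume "\<forall>k<n. fps_nth f k = 0"
  then have "f = fps_X ^ n * fps_shift n f"
    by (auto simp: fps_eq_iff fps_X_power_mult_nth)
  then show "fps_X ^ n dvd f" by (rule dvdI)
qed

lemma dvd_diff_mult:
  fixes d :: "'a::comm_ring_1"
  assumes "d dvd x - x'" "d dvd y - y'"
  shows "d dvd x * y - x' * y'"
proof -
  have "x * y - x' * y' = (x - x') * y + x' * (y - y')" by (simp add: algebra_simps)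
  then show ?thesis using assms by simp
qed

lemma fps_partial_products_agree:
  fixes f :: "nat \<Rightarrow> 'a::comm_ring_1 fps"
  assumes "\<And>i. fps_X ^ Suc i dvd f i - 1" "n \<le> N"
  shows "fps_X ^ n dvd (\<Prod>i<N. f i) - (\<Prod>i<n. f i)"
  using assms(2)
proof (induction rule: dec_induct)
  case (step N)
  have "fps_X ^ n dvd f N - 1"
    using assms(1)[of N] step(1) by (meson dvd_trans le_imp_power_dvd le_SucI)
  from dvd_diff_mult[OF step(3) this] show ?case by simp
qed simp

text \<open>
  If $f_i \equiv 1$ modulo $X^{i+1}$, the $k$-th coefficient of the partial products no longer
  changes after $k + 1$ factors. The series of these stable coefficients is the limit, and since
  $f_0 \equiv 1$ modulo $X$ its constant coefficient is $1$. So it is nonzero, as the notion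
  of a convergent product demands.
\<close>

lemma fps_prodinf_agrees:
  fixes f :: "nat \<Rightarrow> 'a::field fps"
  assumes f: "\<And>i. fps_X ^ Suc i dvd f i - 1"
  shows "fps_X ^ n dvd prodinf f - (\<Prod>i<n. f i)"
proof -
  define P where "P = Abs_fps (\<lambda>k. fps_nth (\<Prod>i<Suc k. f i) k)"
  have nth: "fps_nth (\<Prod>i<N. f i) k = fps_nth P k" if "k < N" for k N
    using fps_partial_products_agree[OF f, of "Suc k" N] that
    by (simp add: fps_X_power_dvd_iff P_def del: prod.lessThan_Suc power_Suc)
  have "(\<lambda>N. \<Prod>i\<le>N. f i) \<longlonglongrightarrow> P"
  proof (rule tendsto_fpsI)
    fix k
    show "eventually (\<lambda>N. fps_nth (\<Prod>i\<le>N. f i) k = fps_nth P k) sequentially"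
      using eventually_ge_at_top[of k]
      by eventually_elim
         (simp add: nth le_imp_less_Suc lessThan_Suc_atMost[symmetric] del: prod.lessThan_Suc)
  qed
  moreover have "fps_nth P 0 = 1"
    using f[of 0] unfolding fps_X_power_dvd_iff by (simp add: P_def)
  then have "P \<noteq> 0" by auto
  ultimately have "f has_prod P" by (simp add: has_prod_def raw_has_prod_def)
  then have "prodinf f = P" by (rule has_prod_unique[symmetric])
  then show ?thesis using nth by (simp add: fps_X_power_dvd_iff)
qed

section \<open>Gaussian binomial coefficients\<close>

text \<open>
  The Gaussian binomial coefficient $\binom{N}{j}_v$. The recursion is the $q$-Pascal rule that
  results from splitting off the last factor in the $q$-binomial theorem; it makes sense
  over any commutative ring, where the usual quotient of products need not exist.
\<close>

fun qbinomial :: "'a::comm_ring_1 \<Rightarrow> nat \<Rightarrow> nat \<Rightarrow> 'a" where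
  "qbinomial v N 0 = 1"
| "qbinomial v 0 (Suc j) = 0"
| "qbinomial v (Suc N) (Suc j) = qbinomial v N (Suc j) + v ^ (N - j) * qbinomial v N j"

lemma qbinomial_eq_0: "N < j \<Longrightarrow> qbinomial v N j = 0"
  by (induction v N j rule: qbinomial.induct) auto

text \<open>
  The $q$-factorial up to the factor $(1 - v)^N$; in the usual notation $(v;v)_N$.
\<close>

definition qfact :: "'a::comm_ring_1 \<Rightarrow> nat \<Rightarrow> 'a" where
  "qfact v N = (\<Prod>i<N. 1 - v ^ Suc i)"

lemma qfact_Suc: "qfact v (Suc N) = qfact v N * (1 - v ^ Suc N)"
  by (simp add: qfact_def)

text \<open>
  The quotient formula for Gaussian binomials with denominators cleared. In the induction step
  both terms of the $q$-Pascal rule contribute a multiple of $(v;v)_N$, and the two cofactors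
  $1 - v^{N-j}$ and $v^{N-j}(1 - v^{j+1})$ add up to $1 - v^{N+1}$.
\<close>

lemma qbinomial_qfact:
  "j \<le> N \<Longrightarrow> qbinomial v N j * (qfact v j * qfact v (N - j)) = qfact v N"
proof (induction v N j rule: qbinomial.induct)
  case (3 v N j)
  show ?case
  proof (cases "j = N")
    case True
    have "qfact v (N - N) = 1" by (simp add: qfact_def)
    then show ?thesis using True 3(2) by (simp add: qbinomial_eq_0 qfact_Suc mult.assoc[symmetric])
  next
    case False
    with 3 have j: "j < N" by simp
    define G1 G0 where "G1 = qbinomial v N (Suc j)" and "G0 = qbinomial v N j"
    define a c where "a = qfact v j" and "c = qfact v (N - Suc j)"
    have Nj: "qfact v (N - j) = c * (1 - v ^ (N - j))"
      using j qfact_Suc[of v "N - Suc j"] by (simp add: c_def Suc_diff_Suc)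
    have e: "v ^ (N - j) * v ^ Suc j = v ^ Suc N"
      using j power_add[of v "N - j" "Suc j"] by simp
    have 1: "G1 * (a * (1 - v ^ Suc j) * c) = qfact v N"
      using 3(1) j by (simp add: G1_def a_def c_def qfact_Suc)
    have 2: "G0 * (a * (c * (1 - v ^ (N - j)))) = qfact v N"
      using 3(2) j by (simp add: G0_def a_def Nj)
    have "qbinomial v (Suc N) (Suc j) * (qfact v (Suc j) * qfact v (Suc N - Suc j))
        = (G1 * (a * (1 - v ^ Suc j) * c)) * (1 - v ^ (N - j))
          + v ^ (N - j) * (1 - v ^ Suc j) * (G0 * (a * (c * (1 - v ^ (N - j)))))"
      by (simp add: G1_def G0_def qfact_Suc Nj a_def algebra_simps)
    also have "\<dots> = qfact v N * (1 - v ^ (N - j) * v ^ Suc j)"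
      unfolding 1 2 by (simp add: algebra_simps)
    finally show ?thesis unfolding e qfact_Suc .
  qed
qed (simp_all add: qfact_def)

text \<open>
  The homogeneous form in $x$ and $y$ is what allows the triple product below to be derived without
  negative powers of $X$.
\<close>

theorem q_binomial_theorem:
  fixes x y v :: "'a::comm_ring_1"
  shows "(\<Prod>i<N. x + y * v ^ i)
       = (\<Sum>j\<le>N. qbinomial v N j * v ^ (j * (j - 1) div 2) * y ^ j * x ^ (N - j))"
proof (induction N)
  case (Suc N)
  define t where "t M j = qbinomial v M j * v ^ (j * (j - 1) div 2) * y ^ j * x ^ (M - j)" for M j
  have t0: "t (Suc N) 0 = x * t N 0" by (simp add: t_def)
  have step: "t (Suc N) (Suc j) = x * t N (Suc j) + y * v ^ N * t N j" if "j \<le> N" for j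
  proof -
    have "Suc j * (Suc j - 1) div 2 = j * (j - 1) div 2 + j"
      by (cases j) auto
    then have expo: "v ^ (Suc j * (Suc j - 1) div 2) = v ^ (j * (j - 1) div 2) * v ^ j"
      by (simp only: power_add)
    have vN: "v ^ N = v ^ (N - j) * v ^ j" using that by (simp flip: power_add)
    have q: "qbinomial v N (Suc j) * x ^ (N - j) = x * (qbinomial v N (Suc j) * x ^ (N - Suc j))"
    proof (cases "j = N")
      case False
      then have "N - j = Suc (N - Suc j)" using that by simp
      then show ?thesis by simp
    qed (simp add: qbinomial_eq_0)
    have "t (Suc N) (Suc j)
        = (qbinomial v N (Suc j) * x ^ (N - j)) * (v ^ (Suc j * (Suc j - 1) div 2) * y ^ Suc j)
          + y * v ^ N * t N j"
      unfolding t_def expo vN by (simp add: ring_distribs mult_ac)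
    also have "\<dots> = x * t N (Suc j) + y * v ^ N * t N j"
      unfolding q t_def expo by (simp only: mult_ac)
    finally show ?thesis .
  qed
  have "(\<Prod>i<Suc N. x + y * v ^ i) = (\<Sum>j\<le>N. t N j) * (x + y * v ^ N)"
    using Suc by (simp add: t_def)
  also have "\<dots> = (\<Sum>j\<le>Suc N. x * t N j) + (\<Sum>j\<le>N. y * v ^ N * t N j)"
    by (simp add: t_def[of N "Suc N"] qbinomial_eq_0 sum_distrib_left ring_distribs mult.commute)
  also have "(\<Sum>j\<le>Suc N. x * t N j) = x * t N 0 + (\<Sum>j\<le>N. x * t N (Suc j))"
    by (rule sum.atMost_Suc_shift)
  also have "\<dots> + (\<Sum>j\<le>N. y * v ^ N * t N j) = t (Suc N) 0 + (\<Sum>j\<le>N. t (Suc N) (Suc j))"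
    by (simp add: step t0 sum.distrib)
  also have "\<dots> = (\<Sum>j\<le>Suc N. t (Suc N) j)" by (rule sum.atMost_Suc_shift[symmetric])
  finally show ?case by (simp only: t_def)
qed simp

section \<open>The Jacobi triple product\<close>

text \<open>
  The exponent of the $k$-th term in the triple product
  $(q^\alpha, q^\beta, q^{\alpha+\beta}; q^{\alpha+\beta})_\infty = \sum_k (-1)^k q^{e_k}$, written with
  triangular numbers so that it is visibly a natural number for every integer $k$.
\<close>

definition theta_exponent :: "nat \<Rightarrow> nat \<Rightarrow> int \<Rightarrow> nat" where
  "theta_exponent \<alpha> \<beta> k = \<alpha> * nat (k * (k - 1) div 2) + \<beta> * nat (k * (k + 1) div 2)"

definition alt_sign :: "int \<Rightarrow> 'a::comm_ring_1" where
  "alt_sign k = (if even k then 1 else -1)"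

lemma consecutive_product_nonneg: "0 \<le> k * (k - 1)" for k :: int
  by (cases "k \<ge> 1") (simp_all add: mult_nonpos_nonpos)

lemma two_theta_exponent:
  "2 * int (theta_exponent \<alpha> \<beta> k) = int \<alpha> * (k * (k - 1)) + int \<beta> * (k * (k + 1))"
proof -
  have nn: "0 \<le> k * (k - 1)" "0 \<le> k * (k + 1)"
    using consecutive_product_nonneg[of k] consecutive_product_nonneg[of "k + 1"]
    by (simp_all add: mult.commute)
  have "2 * (k * (k - 1) div 2) = k * (k - 1)" "2 * (k * (k + 1) div 2) = k * (k + 1)"
    by simp_all
  moreover have "2 * int (theta_exponent \<alpha> \<beta> k)
      = int \<alpha> * (2 * (k * (k - 1) div 2)) + int \<beta> * (2 * (k * (k + 1) div 2))"
    using nn by (simp add: theta_exponent_def algebra_simps)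
  ultimately show ?thesis by simp
qed

text \<open>
  This growth makes the bilateral sum well defined: only finitely many $k$ contribute to a given
  degree.
\<close>

lemma abs_le_theta_exponent:
  assumes "\<alpha> > 0" "\<beta> > 0"
  shows "\<bar>k\<bar> \<le> int (theta_exponent \<alpha> \<beta> k)"
proof -
  have nn: "0 \<le> k * (k - 1)" "0 \<le> k * (k + 1)"
    using consecutive_product_nonneg[of k] consecutive_product_nonneg[of "k + 1"]
    by (simp_all add: mult.commute)
  have "1 * (k * (k - 1)) \<le> int \<alpha> * (k * (k - 1))" "1 * (k * (k + 1)) \<le> int \<beta> * (k * (k + 1))"
    by (rule mult_right_mono; use assms nn in simp)+
  then have "2 * k ^ 2 \<le> 2 * int (theta_exponent \<alpha> \<beta> k)"
    unfolding two_theta_exponent by (simp add: algebra_simps power2_eq_square)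
  moreover have "\<bar>k\<bar> \<le> k ^ 2"
    using self_le_power[of "\<bar>k\<bar>" 2] by (cases "k = 0") auto
  ultimately show ?thesis by linarith
qed

text \<open>
  With $m = \alpha + \beta$, apply the $q$-binomial theorem with $v = X^m$ to the $2n$ factors
  $X^{mn} - X^{\beta + mi}$. For $i \ge n$ such a factor is $X^{mn}(1 - X^{\beta + m(i-n)})$, and for
  $i < n$ it is $-X^{\beta + mi}(1 - X^{\alpha + m(n-1-i)})$. So the product is the left-hand side times
  a signed power of $X$, and this power divides every term of the sum because the
  exponents, after the shift $j = n + k$, differ from it by the exponent of the $k$-th theta term.
\<close>

lemma finite_triple_product:
  fixes \<alpha> \<beta> n :: nat
  defines "m \<equiv> \<alpha> + \<beta>"
  shows "(\<Prod>i<n. (1 - fps_X ^ (\<alpha> + m * i)) * (1 - fps_X ^ (\<beta> + m * i)))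
       = (\<Sum>k\<in>{-int n..int n}. alt_sign k * qbinomial (fps_X ^ m) (2 * n) (nat (int n + k))
            * (fps_X :: 'a::idom fps) ^ theta_exponent \<alpha> \<beta> k)"
proof -
  define X where "X = (fps_X :: 'a fps)"
  \<comment> \<open>$(-1)^n X^E$ is the monomial split off from the $2n$ factors; $X^S$ is the part of it that comes
    from the factors with $i < n$.\<close>
  define S where "S = n * \<beta> + m * (n * (n - 1) div 2)"
  define E where "E = m * n * n + S"
  have 1: "(\<Prod>i<2 * n. X ^ (m * n) + (- (X ^ \<beta>)) * (X ^ m) ^ i)
      = (-1) ^ n * X ^ E * (\<Prod>i<n. (1 - X ^ (\<alpha> + m * i)) * (1 - X ^ (\<beta> + m * i)))"
  proof -
    let ?f = "\<lambda>i. X ^ (m * n) + (- (X ^ \<beta>)) * (X ^ m) ^ i"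
    have "{..<2 * n} = {..<n} \<union> {n..<n + n}" by auto
    then have "(\<Prod>i<2 * n. ?f i) = (\<Prod>i<n. ?f i) * (\<Prod>i\<in>{n..<n + n}. ?f i)"
      by (simp add: prod.union_disjoint ivl_disj_int)
    also have "(\<Prod>i\<in>{n..<n + n}. ?f i) = (\<Prod>i<n. ?f (i + n))"
      using prod.shift_bounds_nat_ivl[of ?f 0 n n] by (simp add: atLeast0LessThan)
    also have "\<dots> = (\<Prod>i<n. X ^ (m * n) * (1 - X ^ (\<beta> + m * i)))"
      by (rule prod.cong) (auto simp: power_add power_mult [symmetric] algebra_simps)
    also have "\<dots> = X ^ (m * n * n) * (\<Prod>i<n. 1 - X ^ (\<beta> + m * i))"
      by (simp add: prod.distrib power_mult)
    also have "(\<Prod>i<n. ?f i) = (\<Prod>i<n. (- (X ^ (\<beta> + m * i))) * (1 - X ^ (\<alpha> + m * (n - Suc i))))"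
    proof (rule prod.cong)
      fix i assume "i \<in> {..<n}"
      then obtain d where d: "n = i + Suc d" by (auto simp: less_iff_Suc_add)
      have e: "m * n = (\<beta> + m * i) + (\<alpha> + m * d)" by (simp add: d m_def algebra_simps)
      show "?f i = (- (X ^ (\<beta> + m * i))) * (1 - X ^ (\<alpha> + m * (n - Suc i)))"
        unfolding e by (simp add: d power_add power_mult [symmetric] algebra_simps)
    qed simp
    also have "\<dots> = (\<Prod>i<n. - (X ^ (\<beta> + m * i))) * (\<Prod>i<n. 1 - X ^ (\<alpha> + m * i))"
      by (simp only: prod.distrib prod.nat_diff_reindex[of "\<lambda>i. 1 - X ^ (\<alpha> + m * i)" n])
    also have "(\<Prod>i<n. - (X ^ (\<beta> + m * i))) = (-1) ^ n * X ^ S"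
    proof -
      have "(\<Prod>i<n. - (X ^ (\<beta> + m * i))) = (-1) ^ n * X ^ (\<Sum>i<n. \<beta> + m * i)"
        by (simp add: prod_uminus power_sum)
      also have "(\<Sum>i<n. \<beta> + m * i) = n * \<beta> + m * (\<Sum>i<n. i)"
        by (simp add: sum.distrib sum_distrib_left)
      also have "(\<Sum>i<n. i) = n * (n - 1) div 2"
        using Sum_Ico_nat[of 0 n] by (simp add: atLeast0LessThan)
      finally show ?thesis by (simp add: S_def)
    qed
    finally show ?thesis
      by (simp add: E_def power_add prod.distrib mult_ac)
  qed
  have 2: "(\<Prod>i<2 * n. X ^ (m * n) + (- (X ^ \<beta>)) * (X ^ m) ^ i)
      = (-1) ^ n * X ^ E * (\<Sum>k\<in>{-int n..int n}. alt_sign k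
            * qbinomial (X ^ m) (2 * n) (nat (int n + k)) * X ^ theta_exponent \<alpha> \<beta> k)"
  proof -
    have "(\<Prod>i<2 * n. X ^ (m * n) + (- (X ^ \<beta>)) * (X ^ m) ^ i)
        = (\<Sum>j\<le>2 * n. qbinomial (X ^ m) (2 * n) j * (X ^ m) ^ (j * (j - 1) div 2)
              * (- (X ^ \<beta>)) ^ j * (X ^ (m * n)) ^ (2 * n - j))"
      by (rule q_binomial_theorem)
    also have "\<dots> = (\<Sum>j\<le>2 * n. (-1) ^ n * X ^ E * (alt_sign (int j - int n)
            * qbinomial (X ^ m) (2 * n) j * X ^ theta_exponent \<alpha> \<beta> (int j - int n)))"
    proof (rule sum.cong)
      fix j assume "j \<in> {..2 * n}"
      then have j: "j \<le> 2 * n" by simp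
      have sgn: "(-1 :: 'a fps) ^ j = (-1) ^ n * alt_sign (int j - int n)"
        by (auto simp: alt_sign_def uminus_power_if)
      have tri: "2 * int (i * (i - 1) div 2) = int i * (int i - 1)" for i
      proof -
        have "even (i * (i - 1))" by (cases i) auto
        then have "2 * (i * (i - 1) div 2) = i * (i - 1)" by (rule dvd_mult_div_cancel)
        then have "2 * int (i * (i - 1) div 2) = int (i * (i - 1))" by linarith
        then show ?thesis by (cases i) (auto simp: algebra_simps)
      qed
      have nd: "int (2 * n - j) = 2 * int n - int j" using j by simp
      have "2 * int (m * (j * (j - 1) div 2) + \<beta> * j + m * n * (2 * n - j))
          = int m * (2 * int (j * (j - 1) div 2)) + 2 * int \<beta> * int j
            + 2 * int m * int n * (2 * int n - int j)"
        unfolding of_nat_add of_nat_mult nd by (simp add: algebra_simps)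
      also have "\<dots> = 2 * int m * int n * int n + 2 * int n * int \<beta>
            + int m * (2 * int (n * (n - 1) div 2))
            + 2 * int (theta_exponent \<alpha> \<beta> (int j - int n))"
        unfolding tri two_theta_exponent by (simp add: m_def algebra_simps)
      also have "\<dots> = 2 * int (E + theta_exponent \<alpha> \<beta> (int j - int n))"
        by (simp add: E_def S_def algebra_simps)
      finally have "int (m * (j * (j - 1) div 2) + \<beta> * j + m * n * (2 * n - j))
          = int (E + theta_exponent \<alpha> \<beta> (int j - int n))"
        by (rule iffD1[OF mult_left_cancel, rotated]) simp
      then have ex: "m * (j * (j - 1) div 2) + \<beta> * j + m * n * (2 * n - j)
          = E + theta_exponent \<alpha> \<beta> (int j - int n)" by (rule iffD1[OF of_nat_eq_iff])
      have "(X ^ m) ^ (j * (j - 1) div 2) * (- (X ^ \<beta>)) ^ j * (X ^ (m * n)) ^ (2 * n - j)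
          = (-1) ^ j * X ^ (m * (j * (j - 1) div 2) + \<beta> * j + m * n * (2 * n - j))"
        by (simp only: power_add power_mult power_minus[of "X ^ \<beta>"] mult_ac)
      also have "\<dots> = (-1) ^ n * X ^ E
          * (alt_sign (int j - int n) * X ^ theta_exponent \<alpha> \<beta> (int j - int n))"
        unfolding ex sgn power_add by (simp only: mult_ac)
      finally show "qbinomial (X ^ m) (2 * n) j * (X ^ m) ^ (j * (j - 1) div 2)
              * (- (X ^ \<beta>)) ^ j * (X ^ (m * n)) ^ (2 * n - j)
          = (-1) ^ n * X ^ E * (alt_sign (int j - int n)
            * qbinomial (X ^ m) (2 * n) j * X ^ theta_exponent \<alpha> \<beta> (int j - int n))"
        by (simp only: mult.assoc) (simp only: mult_ac)
    qed simp
    also have "\<dots> = (\<Sum>k\<in>{-int n..int n}. (-1) ^ n * X ^ E * (alt_sign k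
            * qbinomial (X ^ m) (2 * n) (nat (int n + k)) * X ^ theta_exponent \<alpha> \<beta> k))"
      by (rule sum.reindex_bij_witness[of _ "\<lambda>k. nat (int n + k)" "\<lambda>j. int j - int n"]) auto
    finally show ?thesis by (simp only: sum_distrib_left)
  qed
  have "(-1) ^ n * X ^ E \<noteq> 0" by (simp add: X_def)
  with 1 2 show ?thesis unfolding X_def by simp
qed

lemma qfact_fps_X_power_agrees:
  assumes "m > 0" "n \<le> N"
  shows "fps_X ^ n dvd qfact (fps_X ^ m :: 'a::comm_ring_1 fps) N - qfact (fps_X ^ m) n"
  unfolding qfact_def
proof (rule fps_partial_products_agree[OF _ assms(2)])
  fix i
  have "fps_X ^ Suc i dvd ((fps_X :: 'a fps) ^ m) ^ Suc i"
    unfolding power_mult[symmetric] using mult_le_mono1[of 1 m "Suc i"] assms(1)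
    by (intro le_imp_power_dvd) simp
  then show "fps_X ^ Suc i dvd 1 - (fps_X ^ m) ^ Suc i - (1 :: 'a fps)" by simp
qed

text \<open>
  In the limit, Gaussian binomials far away from both ends become $1/(v;v)_\infty$. Modulo $X^D$
  all the products $(v;v)_i$ with $i \ge D$ agree with $W = (v;v)_D$, so the quotient formula reads
  $G W^2 \equiv W$, and the unit $W$ cancels.
\<close>

lemma qbinomial_times_qfact_agrees:
  assumes "m > 0" "D \<le> j" "D + j \<le> N" "D \<le> n"
  shows "fps_X ^ D dvd qbinomial (fps_X ^ m) N j * qfact (fps_X ^ m :: 'a::field fps) n - 1"
proof -
  define G where "G = qbinomial (fps_X ^ m :: 'a fps) N j"
  define q where "q = qfact (fps_X ^ m :: 'a fps)"
  have ag: "fps_X ^ D dvd q M - q D" if "D \<le> M" for M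
    using qfact_fps_X_power_agrees[OF assms(1) that] by (simp add: q_def)
  have "fps_X ^ D dvd G * (q j * q (N - j)) - G * (q D * q D)"
    by (intro dvd_diff_mult ag) (use assms in auto)
  moreover have "G * (q j * q (N - j)) = q N"
    unfolding G_def q_def by (rule qbinomial_qfact) (use assms in simp)
  moreover have "fps_X ^ D dvd q N - q D" by (rule ag) (use assms in simp)
  ultimately have "fps_X ^ D dvd (q N - q D) - (q N - G * (q D * q D))"
    by (metis dvd_diff)
  then have d: "fps_X ^ D dvd (G * q D - 1) * q D" by (simp add: algebra_simps)
  have "fps_nth (q D) 0 = 1"
  proof -
    have "fps_nth (\<Prod>i\<in>A. 1 - (fps_X ^ m) ^ Suc i :: 'a fps) 0 = 1" if "finite A" for A
      using that assms(1) by (induction A) auto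
    then show ?thesis by (simp add: q_def qfact_def)
  qed
  then have "q D dvd 1" by simp
  then have "fps_X ^ D dvd G * q D - 1" using d by (simp add: dvd_mult_unit_iff)
  moreover have "fps_X ^ D dvd G * q n - G * q D"
    by (intro dvd_diff_mult ag) (use assms in auto)
  ultimately have "fps_X ^ D dvd (G * q n - G * q D) + (G * q D - 1)" by (intro dvd_add)
  then show ?thesis by (simp add: G_def q_def)
qed

text \<open>
  The infinite product agrees modulo $X^{d+1}$ with the finite triple product times $(v;v)_n$ for
  $n = 2(d+1)$. In the finite sum the terms with $|k| \le d + 1$ have a coefficient
  $\binom{2n}{n+k}_v (v;v)_n \equiv 1$, and all others have an exponent above $d$.
\<close>

theorem jacobi_triple_product_fps:
  assumes "\<alpha> > 0" "\<beta> > 0"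
  shows "fps_nth (qpochhammer_inf [fps_X ^ \<alpha>, fps_X ^ \<beta>, fps_X ^ (\<alpha> + \<beta>)]
            (fps_X ^ (\<alpha> + \<beta>)) :: 'a::field fps) d
         = (\<Sum>k | theta_exponent \<alpha> \<beta> k = d. alt_sign k)"
proof -
  define m where "m = \<alpha> + \<beta>"
  define X where "X = (fps_X :: 'a fps)"
  define f where "f i = (1 - X ^ \<alpha> * (X ^ m) ^ i) * ((1 - X ^ \<beta> * (X ^ m) ^ i)
      * (1 - X ^ m * (X ^ m) ^ i))" for i
  define D where "D = Suc d"
  \<comment> \<open>With $n = 2D$ both $n + k$ and $n - k$ are at least $D$ for all $|k| \le D$.\<close>
  define n where "n = 2 * D"
  define G where "G k = qbinomial (X ^ m) (2 * n) (nat (int n + k))" for k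
  define T where "T k = X ^ theta_exponent \<alpha> \<beta> k" for k
  have m: "m > 0" using assms by (simp add: m_def)
  have f_agrees: "X ^ Suc i dvd f i - 1" for i
  proof -
    have X: "X ^ Suc i dvd (1 - X ^ a * (X ^ m) ^ i) - 1" if "a > 0" for a
    proof -
      have "i \<le> m * i" using m by (cases m) auto
      then have "Suc i \<le> a + m * i" using that by linarith
      then have "X ^ Suc i dvd X ^ (a + m * i)" by (rule le_imp_power_dvd)
      then show ?thesis by (simp add: power_add power_mult)
    qed
    have "X ^ Suc i dvd f i - 1 * (1 * 1)"
      unfolding f_def by (intro dvd_diff_mult X assms m)
    then show ?thesis by simp
  qed
  have "X ^ n dvd prodinf f - (\<Prod>i<n. f i)"
    using fps_prodinf_agrees[of f n] f_agrees by (simp add: X_def)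
  then have "X ^ D dvd prodinf f - (\<Prod>i<n. f i)"
    by (rule dvd_trans[rotated]) (simp add: le_imp_power_dvd n_def)
  also have "(\<Prod>i<n. f i)
      = (\<Prod>i<n. (1 - X ^ (\<alpha> + m * i)) * (1 - X ^ (\<beta> + m * i))) * qfact (X ^ m) n"
    unfolding f_def qfact_def prod.distrib[symmetric]
    by (rule prod.cong) (simp_all add: power_add power_mult mult.assoc)
  also have "\<dots> = (\<Sum>k\<in>{-int n..int n}. alt_sign k * T k * (G k * qfact (X ^ m) n))"
    unfolding X_def m_def finite_triple_product sum_distrib_right
    by (simp add: G_def T_def X_def m_def mult_ac)
  finally have 1: "X ^ D dvd prodinf f
      - (\<Sum>k\<in>{-int n..int n}. alt_sign k * T k * (G k * qfact (X ^ m) n))" .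
  have 2: "X ^ D dvd (\<Sum>k\<in>{-int n..int n}. alt_sign k * T k * (G k * qfact (X ^ m) n))
      - (\<Sum>k\<in>{-int n..int n}. alt_sign k * T k)"
    unfolding sum_subtractf[symmetric]
  proof (rule dvd_sum)
    fix k assume "k \<in> {-int n..int n}"
    show "X ^ D dvd alt_sign k * T k * (G k * qfact (X ^ m) n) - alt_sign k * T k"
    proof (cases "\<bar>k\<bar> \<le> int D")
      case True
      then have "X ^ D dvd G k * qfact (X ^ m) n - 1"
        unfolding G_def X_def
        by (intro qbinomial_times_qfact_agrees m) (auto simp: n_def)
      then have "X ^ D dvd alt_sign k * T k * (G k * qfact (X ^ m) n - 1)" by (rule dvd_mult)
      then show ?thesis by (simp add: algebra_simps)
    next
      case False
      then have "D \<le> theta_exponent \<alpha> \<beta> k"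
        using abs_le_theta_exponent[OF assms, of k] by linarith
      then have "X ^ D dvd T k" unfolding T_def by (rule le_imp_power_dvd)
      then show ?thesis by (intro dvd_diff dvd_mult dvd_mult2)
    qed
  qed
  from dvd_add[OF 1 2]
  have "X ^ D dvd prodinf f - (\<Sum>k\<in>{-int n..int n}. alt_sign k * T k)" by simp
  then have "fps_nth (prodinf f) d = fps_nth (\<Sum>k\<in>{-int n..int n}. alt_sign k * T k) d"
    unfolding X_def D_def fps_X_power_dvd_iff by simp
  also have "\<dots> = (\<Sum>k\<in>{-int n..int n}. if theta_exponent \<alpha> \<beta> k = d then alt_sign k else 0)"
    by (auto simp: fps_sum_nth T_def X_def alt_sign_def fps_X_power_nth intro!: sum.cong)
  also have "\<dots> = (\<Sum>k\<in>{k\<in>{-int n..int n}. theta_exponent \<alpha> \<beta> k = d}. alt_sign k)"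
    by (rule sum.inter_filter[symmetric]) simp
  also have "{k\<in>{-int n..int n}. theta_exponent \<alpha> \<beta> k = d} = {k. theta_exponent \<alpha> \<beta> k = d}"
  proof -
    have "k \<in> {-int n..int n}" if "theta_exponent \<alpha> \<beta> k = d" for k
      using abs_le_theta_exponent[OF assms, of k] that by (auto simp: n_def D_def)
    then show ?thesis by blast
  qed
  finally show ?thesis
    by (simp add: qpochhammer_inf_def f_def X_def m_def)
qed

section \<open>The substitution $q \<mapsto> q^n$\<close>

lemma qdilate_mult:
  assumes "n > 0"
  shows "qdilate n (f * g) = qdilate n f * qdilate n g"
proof (rule qseries_eqI)
  fix e
  have "qconv (qcoeff f) (qcoeff g) (e / of_nat n)
      = qconv (\<lambda>x. qcoeff f (x / of_nat n)) (\<lambda>x. qcoeff g (x / of_nat n)) e"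
    unfolding qconv_def
    by (rule sum.reindex_bij_witness[of _ "\<lambda>x. x / of_nat n" "\<lambda>x. x * of_nat n"])
       (use assms in \<open>auto simp: diff_divide_distrib\<close>)
  then show "qcoeff (qdilate n (f * g)) e = qcoeff (qdilate n f * qdilate n g) e"
    using assms by (simp add: qdilate.rep_eq times_qseries.rep_eq)
qed

lemma qdilate_diff: "qdilate n (f - g) = qdilate n f - qdilate n g"
  by (rule qseries_eqI) (simp add: qdilate.rep_eq minus_qseries.rep_eq)

lemma qdilate_qseries_of_fps:
  fixes f :: "'a::idom fps"
  assumes "n > 0"
  shows "qdilate n (qseries_of_fps f) = qseries_of_fps (f oo fps_X ^ n)"
proof (rule qseries_eqI)
  fix e :: rat
  note coeff = fps_nth_compose_X_power[of f n]
  show "qcoeff (qdilate n (qseries_of_fps f)) e = qcoeff (qseries_of_fps (f oo fps_X ^ n)) e"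
  proof (cases "e \<in> \<nat>")
    case True
    then obtain d where d: "e = of_nat d" by (auto elim: Nats_cases)
    show ?thesis
    proof (cases "n dvd d")
      case True
      then obtain i where i: "d = n * i" by blast
      then have "e / of_nat n = of_nat i" using assms by (simp add: d)
      moreover have "d div n = i" using assms by (simp add: i)
      ultimately show ?thesis
        using assms True
        by (simp add: qdilate.rep_eq qcoeff_qseries_of_fps_of_nat coeff) (simp add: d qcoeff_qseries_of_fps_of_nat coeff)
    next
      case False
      have "e / of_nat n \<notin> \<nat>"
      proof
        assume "e / of_nat n \<in> \<nat>"
        then obtain i where "e / of_nat n = of_nat i" by (auto elim: Nats_cases)
        then have "(of_nat d :: rat) = of_nat (n * i)" using assms by (simp add: d field_simps)
        then have "d = n * i" by (simp only: of_nat_eq_iff)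
        with False show False by simp
      qed
      then show ?thesis
        using assms False
        by (simp add: qdilate.rep_eq qcoeff_qseries_of_fps_eq_0) (simp add: d qcoeff_qseries_of_fps_of_nat coeff)
    qed
  next
    case False
    have "e / of_nat n \<notin> \<nat>"
    proof
      assume "e / of_nat n \<in> \<nat>"
      then have "e / of_nat n * of_nat n \<in> \<nat>" by (rule Nats_mult) simp
      with False assms show False by simp
    qed
    with False assms show ?thesis by (simp add: qdilate.rep_eq qcoeff_qseries_of_fps_eq_0)
  qed
qed

lemma euler_product_agrees:
  assumes "n > 0"
  shows "fps_X ^ D dvd qpochhammer_inf [fps_X ^ n] (fps_X ^ n :: 'a::field fps) - qfact (fps_X ^ n) D"
proof -
  have "fps_X ^ D dvd (\<Prod>i. 1 - (fps_X ^ n) ^ Suc i) - (\<Prod>i<D. 1 - (fps_X ^ n :: 'a fps) ^ Suc i)"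
  proof (rule fps_prodinf_agrees)
    fix i
    have "fps_X ^ Suc i dvd ((fps_X :: 'a fps) ^ n) ^ Suc i"
      unfolding power_mult[symmetric] using mult_le_mono1[of 1 n "Suc i"] assms
      by (intro le_imp_power_dvd) simp
    then show "fps_X ^ Suc i dvd 1 - (fps_X ^ n) ^ Suc i - (1 :: 'a fps)" by simp
  qed
  then show ?thesis by (simp add: qpochhammer_inf_def qfact_def)
qed

lemma euler_product_nth_0:
  assumes "n > 0"
  shows "fps_nth (qpochhammer_inf [fps_X ^ n] (fps_X ^ n :: 'a::field fps)) 0 = 1"
  using euler_product_agrees[OF assms, where 'a = 'a, of 1] assms
  unfolding fps_X_power_dvd_iff by (simp add: qfact_def)

text \<open>
  An infinite product cannot be composed factor by factor directly. But both sides are determined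
  by their partial products modulo powers of $X$, and for finite products composition with $X^n$ is a
  ring homomorphism; it maps multiples of $X^{d+1}$ to multiples of $X^{d+1}$ because $n > 0$.
\<close>

lemma euler_product_compose:
  assumes "n > 0"
  shows "qpochhammer_inf [fps_X] (fps_X :: 'a::field fps) oo fps_X ^ n
       = qpochhammer_inf [fps_X ^ n] (fps_X ^ n)"
proof -
  define X where "X = (fps_X :: 'a fps)"
  define P where "P n = qpochhammer_inf [X ^ n] (X ^ n)" for n
  have Xn0: "fps_nth (X ^ n) 0 = 0" using assms by (simp add: X_def)
  have Xc: "X ^ k oo X ^ n = (X ^ n) ^ k" for k
    using fps_compose_power[OF Xn0, of X k] Xn0
    by (simp add: X_def)
  have "fps_nth (P 1 oo X ^ n) d = fps_nth (P n) d" for d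
  proof -
    have "X ^ Suc d dvd P 1 - qfact X (Suc d)"
      using euler_product_agrees[of 1 "Suc d", where 'a = 'a] by (simp add: P_def X_def)
    then obtain g where g: "P 1 - qfact X (Suc d) = X ^ Suc d * g" by (rule dvdE)
    have "(P 1 oo X ^ n) - (qfact X (Suc d) oo X ^ n) = (X ^ Suc d * g) oo X ^ n"
      by (simp only: g flip: fps_compose_sub_distrib)
    also have "\<dots> = (X ^ n) ^ Suc d * (g oo X ^ n)"
      by (simp only: fps_compose_mult_distrib[OF Xn0] Xc)
    also have "X ^ Suc d dvd \<dots>"
      unfolding power_mult[symmetric] using mult_le_mono1[of 1 n "Suc d"] assms
      by (intro dvd_mult2 le_imp_power_dvd) simp
    also have "qfact X (Suc d) oo X ^ n = qfact (X ^ n) (Suc d)"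
      unfolding qfact_def
      by (simp only: fps_compose_prod_distrib[OF Xn0] fps_compose_sub_distrib Xc fps_compose_1)
    finally have 1: "X ^ Suc d dvd (P 1 oo X ^ n) - qfact (X ^ n) (Suc d)" .
    have 2: "X ^ Suc d dvd P n - qfact (X ^ n) (Suc d)"
      unfolding P_def X_def by (rule euler_product_agrees[OF assms])
    from dvd_diff[OF 1 2] have "X ^ Suc d dvd (P 1 oo X ^ n) - P n" by simp
    then show ?thesis unfolding X_def fps_X_power_dvd_iff by simp
  qed
  then have "P 1 oo X ^ n = P n" by (simp add: fps_eq_iff)
  then show ?thesis by (simp add: P_def X_def)
qed

lemma qdilate_inverse_euler_product:
  assumes "n > 0"
  shows "qdilate n (qseries_of_fps (1 / qpochhammer_inf [fps_X] fps_X))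
       = qseries_of_fps (1 / qpochhammer_inf [fps_X ^ n] (fps_X ^ n :: 'a::field fps))"
proof -
  define P where "P n = qpochhammer_inf [fps_X ^ n] (fps_X ^ n :: 'a fps)" for n
  have inv: "1 / P k = inverse (P k)" "P k * inverse (P k) = 1" if "k > 0" for k
    using euler_product_nth_0[OF that, where 'a = 'a]
    by (simp_all add: P_def fps_divide_unit inverse_mult_eq_1')
  have Xn0: "fps_nth (fps_X ^ n :: 'a fps) 0 = 0" using assms by simp
  have "inverse (P 1) oo fps_X ^ n = inverse (P 1 oo fps_X ^ n)"
    by (rule fps_inverse_compose[OF Xn0])
       (use euler_product_nth_0[of 1, where 'a = 'a] in \<open>simp add: P_def\<close>)
  also have "P 1 oo fps_X ^ n = P n"
    using euler_product_compose[OF assms, where 'a = 'a] by (simp add: P_def)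
  finally have "qdilate n (qseries_of_fps (1 / P 1)) = qseries_of_fps (1 / P n)"
    by (simp add: qdilate_qseries_of_fps[OF assms] inv assms)
  then show ?thesis by (simp add: P_def)
qed

text \<open>
  With all signs equal there is no cancellation between the terms of a theta series, so identities
  between such series become counts of integers with a prescribed square.
\<close>

lemma qcoeff_dilated_theta:
  assumes "n > 0" "k \<noteq> 0" "d > 0"
  shows "qcoeff (qdilate n (qsum (\<lambda>j::int. qpow (of_int ((k * j + m)\<^sup>2) / of_nat d)))) e
       = (of_nat (card {j. of_nat n * of_int ((k * j + m)\<^sup>2) / of_nat d = e}) :: 'a::comm_ring_1)"
proof -
  let ?F = "\<lambda>j::int. qpow (of_int ((k * j + m)\<^sup>2) / of_nat d) :: 'a qseries"
  have J: "{j. qcoeff (?F j) (e / of_nat n) \<noteq> 0}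
      = {j. of_nat n * of_int ((k * j + m)\<^sup>2) / of_nat d = e}"
    using assms by (auto simp: qpow.rep_eq field_simps split: if_splits)
  have "qcoeff (qdilate n (qsum ?F)) e = qcoeff (qsum ?F) (e / of_nat n)"
    using assms by (simp add: qdilate.rep_eq)
  also have "\<dots> = (\<Sum>j | qcoeff (?F j) (e / of_nat n) \<noteq> 0. qcoeff (?F j) (e / of_nat n))"
    by (rule qcoeff_qsum[OF qsummable_theta[OF assms(2,3)]])
  also have "\<dots> = (\<Sum>j | qcoeff (?F j) (e / of_nat n) \<noteq> 0. 1)"
    by (rule sum.cong) (auto simp: qpow.rep_eq split: if_splits)
  finally show ?thesis unfolding J by simp
qed

section \<open>Regrouping theta series by residue classes\<close>

lemma dvd_range_imp_eq:
  fixes N :: int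
  assumes "N dvd x - y" "0 < x" "x < N" "0 < y" "y < N"
  shows "x = y"
  using assms by (metis mod_eq_dvd_iff mod_pos_pos_trivial less_imp_le)

text \<open>
  Write $x = Mu + Nv$ by Bezout and reduce $u$ modulo $N$ to $r_0$ and $v$ modulo $M$ to $s$. This leaves
  $x = M r_0 + N s + NMw$. If $w$ is even, this is a representation with sign $+$. If $w$ is odd, replacing
  $r_0$ by $r = N - r_0$ and the sign by $-$ changes $w$ to the even number $w + 1$.
  The residues are nonzero because neither $N$ nor $M$ divides $x$.
\<close>

lemma signed_representation_exists:
  fixes N M x :: int
  assumes "coprime N M" "N > 0" "M > 0" "\<not> N dvd x" "\<not> M dvd x"
  obtains \<sigma> r s j where "\<sigma> \<in> {1, -1}" "r \<in> {0<..<N}" "s \<in> {0<..<M}"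
    "x = 2 * N * M * j + (\<sigma> * (M * r) + N * s)"
proof -
  obtain u0 v0 where "u0 * M + v0 * N = gcd M N" using bezout_int by blast
  then have uv0: "u0 * M + v0 * N = 1" using assms(1) by (simp add: coprime_commute)
  define u v where "u = u0 * x" and "v = v0 * x"
  have x: "x = M * u + N * v"
  proof -
    have "M * u + N * v = (u0 * M + v0 * N) * x" by (simp add: u_def v_def algebra_simps)
    then show ?thesis using uv0 by simp
  qed
  define r0 s w where "r0 = u mod N" and "s = v mod M" and "w = u div N + v div M"
  have u: "u = N * (u div N) + r0" and v: "v = M * (v div M) + s"
    by (simp_all add: r0_def s_def)
  have xw: "x = M * r0 + N * s + N * M * w"
    using x by (subst (asm) u, subst (asm) v) (simp add: w_def algebra_simps)
  have "r0 \<noteq> 0" using assms(4) xw by (metis dvd_add dvd_triv_left mult.assoc mult_zero_right add_0)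
  moreover have "s \<noteq> 0"
    using assms(5) xw
    by (metis dvd_add dvd_triv_left mult.assoc mult.commute mult_zero_right add_0_right)
  moreover have "0 \<le> r0" "r0 < N" "0 \<le> s" "s < M" using assms by (simp_all add: r0_def s_def)
  ultimately have rs: "r0 \<in> {0<..<N}" "N - r0 \<in> {0<..<N}" "s \<in> {0<..<M}" by auto
  show thesis
  proof (cases "even w")
    case True
    then obtain j where "w = 2 * j" by blast
    with that[of 1 r0 s j] rs xw show thesis by (simp add: algebra_simps)
  next
    case False
    then have "even (w + 1)" by simp
    then obtain j where "w + 1 = 2 * j" by blast
    then have "w = 2 * j - 1" by simp
    with that[of "-1" "N - r0" s j] rs xw show thesis by (simp add: algebra_simps)
  qed
qed

text \<open>
  Modulo $M$ the value determines $s$, and modulo $N$ it determines $\sigma r$. Equal signs then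
  force $r = r'$. Opposite signs would make $r + r'$ an even multiple of $N$, but
  $0 < r + r' < 2N$.
\<close>

lemma signed_representation_unique:
  fixes N M :: int
  assumes "coprime N M"
    and "\<sigma> \<in> {1, -1}" "r \<in> {0<..<N}" "s \<in> {0<..<M}"
    and "\<sigma>' \<in> {1, -1}" "r' \<in> {0<..<N}" "s' \<in> {0<..<M}"
    and eq: "2 * N * M * j + (\<sigma> * (M * r) + N * s) = 2 * N * M * j' + (\<sigma>' * (M * r') + N * s')"
  shows "\<sigma> = \<sigma>' \<and> r = r' \<and> s = s' \<and> j = j'"
proof -
  have pos: "N > 0" "M > 0" using assms by auto
  have "N * (s - s') = M * (2 * N * (j' - j) + \<sigma>' * r' - \<sigma> * r)"
    using eq by (simp add: algebra_simps)
  then have "M dvd N * (s - s')" by simp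
  then have "M dvd s - s'" using assms(1) by (simp add: coprime_dvd_mult_right_iff coprime_commute)
  then have s: "s = s'" using assms by (intro dvd_range_imp_eq[of M]) auto
  then have "M * (\<sigma> * r - \<sigma>' * r') = M * (N * (2 * (j' - j)))"
    using eq by (simp add: algebra_simps)
  then have d: "\<sigma> * r - \<sigma>' * r' = N * (2 * (j' - j))" using pos by simp
  show ?thesis
  proof (cases "\<sigma> = \<sigma>'")
    case True
    then have "\<sigma> * (r - r') = N * (2 * (j' - j))" using d by (simp add: algebra_simps)
    then have "N dvd \<sigma> * (r - r')" by simp
    then have "N dvd r - r'" using assms(2) by (auto simp: dvd_diff_commute)
    then have r: "r = r'" using assms by (intro dvd_range_imp_eq[of N]) auto
    with d True pos show ?thesis using s by simp
  next
    case False
    then have "r + r' = N * (2 * (j' - j)) \<or> r + r' = N * (2 * (j - j'))"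
      using d assms(2,5) by (auto simp: algebra_simps)
    then obtain i where i: "r + r' = N * (2 * i)" by blast
    have "0 < N * (2 * i)" "N * (2 * i) < N * 2"
      unfolding i[symmetric] using assms(3,6) by auto
    then have "0 < 2 * i" "2 * i < 2" using pos by (simp_all add: zero_less_mult_iff)
    then show ?thesis by simp
  qed
qed

text \<open>
  By the existence and uniqueness of signed representations, the residue class of $t$ modulo $a$ is the
  disjoint union of the progressions $2NMj + (\sigma Mr + Ns)$ whose base point lies in that class;
  the class is a union of classes modulo $2NM$ because $a$ divides $2NM$.
\<close>

lemma card_signed_representations:
  fixes N M a t :: int and S :: "int set"
  assumes "coprime N M" "N > 0" "M > 0" "a dvd 2 * N * M" "finite S"
    and ndvd: "\<And>x. a dvd x - t \<Longrightarrow> \<not> N dvd x \<and> \<not> M dvd x"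
  defines "I \<equiv> \<lambda>\<sigma>. {(r, s). r \<in> {0<..<N} \<and> s \<in> {0<..<M} \<and> a dvd \<sigma> * (M * r) + N * s - t}"
    and "J \<equiv> \<lambda>\<sigma> (r, s). {j. 2 * N * M * j + (\<sigma> * (M * r) + N * s) \<in> S}"
  shows "card {x \<in> S. a dvd x - t} = (\<Sum>\<sigma>\<in>{1, -1}. \<Sum>rs\<in>I \<sigma>. card (J \<sigma> rs))"
proof -
  define f where "f = (\<lambda>(\<sigma>, (r, s), j). 2 * N * M * j + (\<sigma> * (M * r) + N * s))"
  define T where "T = (SIGMA \<sigma>:{1, -1}. SIGMA rs:I \<sigma>. J \<sigma> rs)"
  have finI: "finite (I \<sigma>)" for \<sigma>
    by (rule finite_subset[of _ "{0<..<N} \<times> {0<..<M}"]) (auto simp: I_def)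
  have finJ: "finite (J \<sigma> rs)" for \<sigma> rs
  proof -
    obtain r s where rs: "rs = (r, s)" by (cases rs)
    have "inj (\<lambda>j. 2 * N * M * j + (\<sigma> * (M * r) + N * s))"
      using assms by (auto simp: inj_def)
    from finite_vimageI[OF assms(5) this] show ?thesis by (simp add: J_def rs vimage_def)
  qed
  have shift: "a dvd 2 * N * M * j + y - t \<longleftrightarrow> a dvd y - t" for j y
  proof -
    have "a dvd 2 * N * M * j" using assms(4) by simp
    then have "a dvd 2 * N * M * j + (y - t) \<longleftrightarrow> a dvd y - t" by (rule dvd_add_right_iff)
    then show ?thesis by (simp add: add_diff_eq)
  qed
  have "bij_betw f T {x \<in> S. a dvd x - t}"
  proof (rule bij_betwI')
    fix y y' assume y: "y \<in> T" "y' \<in> T"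
    obtain \<sigma> r s j where y1: "y = (\<sigma>, (r, s), j)" by (metis surj_pair)
    obtain \<sigma>' r' s' j' where y2: "y' = (\<sigma>', (r', s'), j')" by (metis surj_pair)
    show "(f y = f y') = (y = y')"
    proof
      assume "f y = f y'"
      then show "y = y'"
        using signed_representation_unique[OF assms(1), of \<sigma> r s \<sigma>' r' s' j j'] y
        unfolding y1 y2 by (simp add: f_def T_def I_def)
    qed simp
  next
    fix y assume "y \<in> T"
    then show "f y \<in> {x \<in> S. a dvd x - t}"
      by (auto simp: T_def I_def J_def f_def shift)
  next
    fix x assume x: "x \<in> {x \<in> S. a dvd x - t}"
    then have "\<not> N dvd x" "\<not> M dvd x" using ndvd by auto
    from signed_representation_exists[OF assms(1-3) this]
    obtain \<sigma> r s j where *: "\<sigma> \<in> {1, -1}" "r \<in> {0<..<N}" "s \<in> {0<..<M}"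
      "x = 2 * N * M * j + (\<sigma> * (M * r) + N * s)" by blast
    have "(\<sigma>, (r, s), j) \<in> T" using * x by (auto simp: T_def I_def J_def shift)
    moreover have "x = f (\<sigma>, (r, s), j)" using *(4) by (simp add: f_def)
    ultimately show "\<exists>y\<in>T. x = f y" by blast
  qed
  then have "card {x \<in> S. a dvd x - t} = card T" by (rule bij_betw_same_card[symmetric])
  also have "\<dots> = (\<Sum>\<sigma>\<in>{1, -1}. \<Sum>rs\<in>I \<sigma>. card (J \<sigma> rs))"
    by (simp add: T_def card_SigmaI finI finJ finite_SigmaI)
  finally show ?thesis .
qed

text \<open>
  The combinatorial core. The numbers $2ak + c$ with even $k$ form the class of $c$ modulo $4a$, and
  those with odd $k$ the class of $c + 2a$. Each class is split into progressions as above. The set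
  \<open>S\<close> is symmetric, so a progression with sign $-$ may be replaced by the one through $Mr - Ns$.
  For the class of $c$ the index pairs with sign $+$ form \<open>A2\<close> and those with sign $-$
  form \<open>A1\<close>; for the class of $c + 2a$ it is the other way round, because
  $(Mr + Ns) + (Mr - Ns) = 2Mr$ is an odd multiple of $2a$ whenever $r$ is odd. So each pair of
  \<open>A1\<close> and of \<open>A2\<close> contributes exactly one progression to either class, with the signs
  of the two theta series in a character.
\<close>

lemma signed_theta_regrouping:
  fixes N M a c :: int and S :: "int set"
  assumes "coprime N M" "N > 0" "M > 0" "even N" "a dvd M" "odd c" "0 < c" "c < a"
    and S: "finite S" "\<And>x. - x \<in> S \<longleftrightarrow> x \<in> S"
  defines "A1 \<equiv> {(r, s). r \<in> {0<..<N} \<and> s \<in> {0<..<M} \<and> 4 * a dvd M * r - N * s + c}"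
    and "A2 \<equiv> {(r, s). r \<in> {0<..<N} \<and> s \<in> {0<..<M} \<and> 4 * a dvd M * r + N * s - c}"
    and "C1 \<equiv> \<lambda>r s. of_nat (card {j. 2 * N * M * j + (M * r - N * s) \<in> S})"
    and "C2 \<equiv> \<lambda>r s. of_nat (card {j. 2 * N * M * j + (M * r + N * s) \<in> S})"
  shows "(\<Sum>k | 2 * a * k + c \<in> S. alt_sign k :: 'a::comm_ring_1)
       = (\<Sum>(r, s)\<in>A1. C1 r s - C2 r s) - (\<Sum>(r, s)\<in>A2. C1 r s - C2 r s)"
proof -
  have "a > 0" using assms by simp
  obtain M' where M': "M = a * M'" using assms(5) by (rule dvdE)
  obtain N' where N': "N = 2 * N'" using assms(4) by (rule evenE)
  have "4 * a dvd 2 * N * M" by (simp add: M' N')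
  \<comment> \<open>Members of the class of $c$ modulo $2a$ are odd, while $N$ is even, and a multiple of $M$ would be
    a multiple of $a$, against $0 < c < a$.\<close>
  have ndvd: "\<not> N dvd x \<and> \<not> M dvd x" if x: "2 * a dvd x - c" for x
  proof -
    have "even (x - c)" using x by (meson dvd_mult_left)
    then have "odd x" using \<open>odd c\<close> by simp
    then have "\<not> N dvd x" using \<open>even N\<close> dvd_trans by blast
    moreover have "\<not> M dvd x"
    proof
      assume "M dvd x"
      then have "a dvd x" using \<open>a dvd M\<close> by (rule dvd_trans[rotated])
      moreover have "a dvd x - c" using x by (meson dvd_mult_right)
      ultimately have "a dvd c" using dvd_diff[of a x "x - c"] by simp
      then show False using assms(7,8) by (simp add: zdvd_not_zless)
    qed
    ultimately show ?thesis by blast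
  qed
  have half: "2 * a dvd x - c" if "4 * a dvd x - c \<or> 4 * a dvd x - (c + 2 * a)" for x
  proof -
    have "2 * a dvd 4 * a" by (rule dvdI[of _ _ 2]) simp
    then have "2 * a dvd x - c \<or> 2 * a dvd x - (c + 2 * a)" using that dvd_trans by blast
    moreover have "x - c = (x - (c + 2 * a)) + 2 * a" by simp
    ultimately show ?thesis by (metis dvd_add dvd_refl)
  qed
  define I where "I \<sigma> t = {(r, s). r \<in> {0<..<N} \<and> s \<in> {0<..<M} \<and> 4 * a dvd \<sigma> * (M * r) + N * s - t}" for \<sigma> t
  define J where "J = (\<lambda>\<sigma> (r, s). {j. 2 * N * M * j + (\<sigma> * (M * r) + N * s) \<in> S})"
  have cardJ1: "of_nat (card (J 1 (r, s))) = C2 r s" for r s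
    by (simp add: J_def C2_def)
  have cardJ2: "of_nat (card (J (-1) (r, s))) = C1 r s" for r s
  proof -
    have "2 * N * M * - j + (M * r - N * s) = - (2 * N * M * j + (-1 * (M * r) + N * s))" for j
      by simp
    then have mem: "- j \<in> {j. 2 * N * M * j + (M * r - N * s) \<in> S} \<longleftrightarrow> j \<in> J (-1) (r, s)" for j
      unfolding J_def mem_Collect_eq case_prod_conv using S(2) by metis
    have "{j. 2 * N * M * j + (M * r - N * s) \<in> S} = uminus ` J (-1) (r, s)"
    proof (intro equalityI subsetI)
      fix j assume "j \<in> {j. 2 * N * M * j + (M * r - N * s) \<in> S}"
      then have "- j \<in> J (-1) (r, s)" using mem[of "- j"] by simp
      then show "j \<in> uminus ` J (-1) (r, s)" by (intro image_eqI[of _ _ "- j"]) simp_all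
    qed (use mem in blast)
    then show ?thesis by (simp add: C1_def card_image)
  qed
  have card_t: "of_nat (card {x \<in> S. 4 * a dvd x - t})
      = (\<Sum>(r, s)\<in>I 1 t. C2 r s) + (\<Sum>(r, s)\<in>I (-1) t. C1 r s)"
    if t: "t = c \<or> t = c + 2 * a" for t
  proof -
    have "card {x \<in> S. 4 * a dvd x - t} = (\<Sum>\<sigma>\<in>{1, -1}. \<Sum>rs\<in>I \<sigma> t. card (J \<sigma> rs))"
      unfolding I_def J_def
      by (rule card_signed_representations) (use assms(1-3) S(1) \<open>4 * a dvd 2 * N * M\<close> ndvd half t in auto)
    then show ?thesis by (simp add: case_prod_unfold flip: cardJ1 cardJ2)
  qed

  have "odd M"
    using \<open>coprime N M\<close> \<open>even N\<close> coprime_common_divisor[of N M 2] by auto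
  have r_odd: "odd r" if "4 * a dvd M * r + y" "odd y" for r y
  proof -
    have "even (M * r + y)" using that(1) by (meson dvd_trans dvd_mult2 even_numeral)
    then show ?thesis using that(2) by auto
  qed
  have shift: "4 * a dvd 2 * (M * r) + 2 * a" "4 * a dvd 2 * (M * r) - 2 * a" if "odd r" for r
  proof -
    have "odd (M' * r)" using that \<open>odd M\<close> by (simp add: M')
    then obtain i where i: "M' * r = 2 * i + 1" by (rule oddE)
    have "M * r = a * (2 * i + 1)" by (simp add: M' i[symmetric])
    then have "2 * (M * r) + 2 * a = 4 * a * (i + 1)" "2 * (M * r) - 2 * a = 4 * a * i"
      by (simp_all add: algebra_simps)
    then show "4 * a dvd 2 * (M * r) + 2 * a" "4 * a dvd 2 * (M * r) - 2 * a"
      by (metis dvd_triv_left)+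
  qed
  have cond_A1: "4 * a dvd 1 * (M * r) + N * s - (c + 2 * a) \<longleftrightarrow> 4 * a dvd M * r - N * s + c" for r s
  proof -
    define y where "y = - (N * s) + c"
    have "odd y" "odd (N * s - (c + 2 * a))" using \<open>even N\<close> \<open>odd c\<close> by (simp_all add: y_def)
    then have "odd r" if "4 * a dvd M * r + y \<or> 4 * a dvd M * r + (N * s - (c + 2 * a))"
      using that r_odd by blast
    moreover have "4 * a dvd M * r + (N * s - (c + 2 * a)) \<longleftrightarrow> 4 * a dvd M * r + y" if "odd r"
    proof -
      have "M * r + (N * s - (c + 2 * a)) = (2 * (M * r) - 2 * a) - (M * r + y)"
        by (simp add: y_def)
      then show ?thesis using shift(2)[OF that] by (metis dvd_diff_right_iff)
    qed
    ultimately have "4 * a dvd M * r + (N * s - (c + 2 * a)) \<longleftrightarrow> 4 * a dvd M * r + y" by blast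
    then show ?thesis by (simp add: y_def algebra_simps)
  qed
  have cond_A2: "4 * a dvd -1 * (M * r) + N * s - (c + 2 * a) \<longleftrightarrow> 4 * a dvd M * r + N * s - c" for r s
  proof -
    define y where "y = N * s - c"
    have "odd y" "odd (c + 2 * a - N * s)" using \<open>even N\<close> \<open>odd c\<close> by (simp_all add: y_def)
    then have "odd r" if "4 * a dvd M * r + y \<or> 4 * a dvd M * r + (c + 2 * a - N * s)"
      using that r_odd by blast
    moreover have "4 * a dvd M * r + (c + 2 * a - N * s) \<longleftrightarrow> 4 * a dvd M * r + y" if "odd r"
    proof -
      have "M * r + (c + 2 * a - N * s) = (2 * (M * r) + 2 * a) - (M * r + y)"
        by (simp add: y_def)
      then show ?thesis using shift(1)[OF that] by (metis dvd_diff_right_iff)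
    qed
    ultimately have "4 * a dvd M * r + (c + 2 * a - N * s) \<longleftrightarrow> 4 * a dvd M * r + y" by blast
    moreover have "-1 * (M * r) + N * s - (c + 2 * a) = - (M * r + (c + 2 * a - N * s))" by simp
    ultimately show ?thesis by (simp only: dvd_minus_iff y_def add_diff_eq)
  qed
  have cond_neg: "4 * a dvd -1 * (M * r) + N * s - c \<longleftrightarrow> 4 * a dvd M * r - N * s + c" for r s
  proof -
    have "-1 * (M * r) + N * s - c = - (M * r - N * s + c)" by simp
    then show ?thesis by (simp only: dvd_minus_iff)
  qed
  have I: "I 1 c = A2" "I (-1) c = A1" "I 1 (c + 2 * a) = A1" "I (-1) (c + 2 * a) = A2"
    unfolding I_def A1_def A2_def cond_A1 cond_A2 cond_neg by simp_all
  define K where "K = {k. 2 * a * k + c \<in> S}"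
  have inj: "inj (\<lambda>k. 2 * a * k + c)" using \<open>a > 0\<close> by (auto simp: inj_def)
  have "finite K"
    using finite_vimageI[OF S(1) inj] by (simp add: K_def vimage_def)
  have even_K: "card {k \<in> K. even k} = card {x \<in> S. 4 * a dvd x - c}"
  proof (rule bij_betw_same_card)
    show "bij_betw (\<lambda>k. 2 * a * k + c) {k \<in> K. even k} {x \<in> S. 4 * a dvd x - c}"
    proof (rule bij_betw_imageI)
      show "inj_on (\<lambda>k. 2 * a * k + c) {k \<in> K. even k}" using inj by (rule inj_on_subset) simp
      show "(\<lambda>k. 2 * a * k + c) ` {k \<in> K. even k} = {x \<in> S. 4 * a dvd x - c}"
      proof (intro equalityI subsetI)
        fix x assume "x \<in> (\<lambda>k. 2 * a * k + c) ` {k \<in> K. even k}"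
        then show "x \<in> {x \<in> S. 4 * a dvd x - c}" by (auto simp: K_def elim!: evenE)
      next
        fix x assume x: "x \<in> {x \<in> S. 4 * a dvd x - c}"
        then obtain i where "x - c = 4 * a * i" by (auto elim: dvdE)
        then have "x = 2 * a * (2 * i) + c" by simp
        then show "x \<in> (\<lambda>k. 2 * a * k + c) ` {k \<in> K. even k}"
          using x by (intro image_eqI[of _ _ "2 * i"]) (auto simp: K_def)
      qed
    qed
  qed
  have odd_K: "card {k \<in> K. odd k} = card {x \<in> S. 4 * a dvd x - (c + 2 * a)}"
  proof (rule bij_betw_same_card)
    show "bij_betw (\<lambda>k. 2 * a * k + c) {k \<in> K. odd k} {x \<in> S. 4 * a dvd x - (c + 2 * a)}"
    proof (rule bij_betw_imageI)
      show "inj_on (\<lambda>k. 2 * a * k + c) {k \<in> K. odd k}" using inj by (rule inj_on_subset) simp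
      show "(\<lambda>k. 2 * a * k + c) ` {k \<in> K. odd k} = {x \<in> S. 4 * a dvd x - (c + 2 * a)}"
      proof (intro equalityI subsetI)
        fix x assume "x \<in> (\<lambda>k. 2 * a * k + c) ` {k \<in> K. odd k}"
        then show "x \<in> {x \<in> S. 4 * a dvd x - (c + 2 * a)}"
          by (auto simp: K_def algebra_simps elim!: oddE)
      next
        fix x assume x: "x \<in> {x \<in> S. 4 * a dvd x - (c + 2 * a)}"
        then obtain i where "x - (c + 2 * a) = 4 * a * i" by (auto elim: dvdE)
        then have "x = 2 * a * (2 * i + 1) + c" by (simp add: algebra_simps)
        then show "x \<in> (\<lambda>k. 2 * a * k + c) ` {k \<in> K. odd k}"
          using x by (intro image_eqI[of _ _ "2 * i + 1"]) (auto simp: K_def)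
      qed
    qed
  qed
  have "(\<Sum>k\<in>K. alt_sign k :: 'a) = (\<Sum>k\<in>K. if even k then 1 else 0) - (\<Sum>k\<in>K. if odd k then 1 else 0)"
    unfolding sum_subtractf[symmetric] by (rule sum.cong) (auto simp: alt_sign_def)
  also have "\<dots> = of_nat (card {k \<in> K. even k}) - of_nat (card {k \<in> K. odd k})"
    using \<open>finite K\<close> by (simp add: sum.inter_filter[symmetric])
  also have "\<dots> = (\<Sum>(r, s)\<in>A2. C2 r s) + (\<Sum>(r, s)\<in>A1. C1 r s)
      - ((\<Sum>(r, s)\<in>A1. C2 r s) + (\<Sum>(r, s)\<in>A2. C1 r s))"
    by (simp add: even_K odd_K card_t I)
  also have "\<dots> = (\<Sum>(r, s)\<in>A1. C1 r s - C2 r s) - (\<Sum>(r, s)\<in>A2. C1 r s - C2 r s)"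
    by (simp add: sum_subtractf case_prod_unfold)
  finally show ?thesis by (simp add: K_def)
qed

section \<open>Sums of minimal series characters\<close>

lemma sum_qcoeff: "qcoeff (\<Sum>i\<in>A. f i) e = (\<Sum>i\<in>A. qcoeff (f i) e)"
  by (induction A rule: infinite_finite_induct) (simp_all add: zero_qseries.rep_eq plus_qseries.rep_eq)

text \<open>
  The rational conditions on the index pairs become divisibility conditions in the reduced
  moduli $N = p/b$ and $M = p'/b'$, in which the regrouping of theta series is stated.
\<close>

lemma index_set1_eq:
  assumes "b > 0" "b' > 0" "a' > 0" and p: "p = b * N" and p': "p' = b' * M"
  shows "index_set1 p p' a' b b' c = {(r, s). r \<in> {0<..<int N} \<and> s \<in> {0<..<int M} \<and>
           4 * int a' dvd int M * r - int N * s + int c}"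
proof -
  have "(of_nat p' * of_int r / of_nat b' - of_nat p * of_int s / of_nat b + of_nat c)
          / (4 * of_nat a') = (of_int (int M * r - int N * s + int c) / of_int (4 * int a') :: rat)" for r s
    using assms by simp
  moreover have "of_nat p / of_nat b = rat_of_int (int N)" "of_nat p' / of_nat b' = rat_of_int (int M)"
    using assms by simp_all
  ultimately show ?thesis
    using assms(3) unfolding index_set1_def
    by (simp only: of_int_div_of_int_in_Ints_iff of_int_less_iff) auto
qed

lemma index_set2_eq:
  assumes "b > 0" "b' > 0" "a' > 0" and p: "p = b * N" and p': "p' = b' * M"
  shows "index_set2 p p' a' b b' c = {(r, s). r \<in> {0<..<int N} \<and> s \<in> {0<..<int M} \<and>
           4 * int a' dvd int M * r + int N * s - int c}"
proof -
  have "(of_nat p' * of_int r / of_nat b' + of_nat p * of_int s / of_nat b - of_nat c)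
          / (4 * of_nat a') = (of_int (int M * r + int N * s - int c) / of_int (4 * int a') :: rat)" for r s
    using assms by simp
  moreover have "of_nat p / of_nat b = rat_of_int (int N)" "of_nat p' / of_nat b' = rat_of_int (int M)"
    using assms by simp_all
  ultimately show ?thesis
    using assms(3) unfolding index_set2_def
    by (simp only: of_int_div_of_int_in_Ints_iff of_int_less_iff) auto
qed

theorem theorem3p2:
  fixes p p' a' b b' c B n :: nat
  assumes "coprime p p'" and "p > 1" and "p' > 1"
    and "a' > 0" and "b > 0" and "b' > 0"
    and "odd c" and "a' > c"
    and "2 * b dvd p" and "a' * b' dvd p'"
    and "B = b * b'" and "n = p * p' div (2 * a' * b * b')"
  shows "qseries_of_fps
           (qpochhammer_inf
              [fps_X ^ (B * (a' - c) div 2), fps_X ^ (B * (a' + c) div 2), fps_X ^ (B * a')]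
              (fps_X ^ (B * a'))
            / qpochhammer_inf [fps_X ^ n] (fps_X ^ n))
         = qpow (of_int ((int p - int p')\<^sup>2 - (int c * int B)\<^sup>2) / of_nat (8 * B * a'))
           * ((\<Sum>(r, s)\<in>index_set1 p p' a' b b' c.
                 qdilate n (virasoro_char p p' (r * int b) (s * int b')))
              - (\<Sum>(r, s)\<in>index_set2 p p' a' b b' c.
                 qdilate n (virasoro_char p p' (r * int b) (s * int b'))))"
proof -
  obtain N where N: "p = b * N" using \<open>2 * b dvd p\<close> by (meson dvd_def dvd_mult_right)
  obtain M where M: "p' = b' * M" using \<open>a' * b' dvd p'\<close> by (meson dvd_def dvd_mult_right)
  have "even N" using \<open>2 * b dvd p\<close> \<open>b > 0\<close> by (simp add: N mult.commute)
  have "a' dvd M" using \<open>a' * b' dvd p'\<close> \<open>b' > 0\<close> by (simp add: M mult.commute)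
  have "coprime N M" using \<open>coprime p p'\<close> by (simp add: N M)
  have "N > 0" "M > 0" using \<open>p > 1\<close> \<open>p' > 1\<close> by (auto simp: N M intro: Nat.gr0I)
  have "B > 0" using assms by simp
  have c: "0 < c" using \<open>odd c\<close> by (cases c) auto
  have "n * (2 * a' * b * b') = p * p'"
    using exact_divisions(1)[OF assms(1-10)] unfolding assms(12) by (rule dvd_div_mult_self)
  then have n: "n * (2 * a' * B) = p * p'" by (simp add: assms(11) mult.assoc)
  have "n > 0"
    using exact_divisions(2)[OF assms(1-10)] unfolding assms(12) .
  define \<alpha> \<beta> where "\<alpha> = B * (a' - c) div 2" and "\<beta> = B * (a' + c) div 2"
  have ev: "2 dvd B * (a' - c)" "2 dvd B * (a' + c)"
    using exact_divisions(3,4)[OF assms(1-10)] by blast+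
  have two\<alpha>: "2 * \<alpha> = B * (a' - c)" and two\<beta>: "2 * \<beta> = B * (a' + c)"
    using ev by (simp_all add: \<alpha>_def \<beta>_def)
  have "2 * (\<alpha> + \<beta>) = B * ((a' - c) + (a' + c))" by (simp only: distrib_left two\<alpha> two\<beta>)
  also have "(a' - c) + (a' + c) = 2 * a'" using \<open>a' > c\<close> by simp
  finally have \<alpha>\<beta>: "\<alpha> + \<beta> = B * a'" by simp
  have "0 < 2 * \<alpha>" "0 < 2 * \<beta>" unfolding two\<alpha> two\<beta> using \<open>B > 0\<close> \<open>a' > c\<close> by simp_all
  then have \<alpha>: "\<alpha> > 0" and \<beta>: "\<beta> > 0" by simp_all

  \<comment> \<open>$q^{-h}$ completes the square: $e_k + h = B(2a'k + c)^2 / (8a')$ for the exponents $e_k$ of the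
    triple product.\<close>
  define h where "h = of_nat B * (of_nat c)\<^sup>2 / (8 * of_nat a' :: rat)"
  define d where "d = 4 * p * p'"
  define U :: "complex qseries" where
    "U = qseries_of_fps (1 / qpochhammer_inf [fps_X ^ n] (fps_X ^ n))"
  define P :: "complex fps" where "P = qpochhammer_inf [fps_X ^ \<alpha>, fps_X ^ \<beta>, fps_X ^ (B * a')] (fps_X ^ (B * a'))"
  define \<theta> :: "int \<Rightarrow> complex qseries" where
    "\<theta> m = qdilate n (qsum (\<lambda>j::int. qpow (of_int ((2 * int p * int p' * j + m)\<^sup>2) / of_nat d)))" for m
  define \<Delta> where "\<Delta> = (\<lambda>(r, s). \<theta> (int p' * (r * int b) - int p * (s * int b'))
                               - \<theta> (int p' * (r * int b) + int p * (s * int b')))"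
  define L where "L = of_nat n * of_int ((int p' - int p)\<^sup>2) / (of_nat d :: rat)"
  have d: "d = n * (8 * a' * B)" unfolding d_def mult.assoc[of 4] n[symmetric] by simp

  have char: "qdilate n (virasoro_char p p' (r * int b) (s * int b')) = qpow (- L) * U * \<Delta> (r, s)" for r s
    unfolding virasoro_char_def qdilate_mult[OF \<open>n > 0\<close>] qdilate_diff qdilate_qpow[OF \<open>n > 0\<close>]
      qdilate_inverse_euler_product[OF \<open>n > 0\<close>]
    by (simp add: L_def U_def \<Delta>_def \<theta>_def d_def add_diff_eq flip: add.assoc)
  \<comment> \<open>The prefactor of the identity and the common prefactor of the dilated characters leave only
    $q^{-h}$.\<close>
  have L: "of_int ((int p - int p')\<^sup>2 - (int c * int B)\<^sup>2) / of_nat (8 * B * a') + - L = - h"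
    using \<open>n > 0\<close> \<open>B > 0\<close> \<open>a' > 0\<close> unfolding L_def d h_def
    by (simp add: field_simps power2_eq_square)
  let ?A1 = "index_set1 p p' a' b b' c" and ?A2 = "index_set2 p p' a' b b' c"
  define R where "R = (\<Sum>rs\<in>?A1. \<Delta> rs) - (\<Sum>rs\<in>?A2. \<Delta> rs)"

  have P: "qseries_of_fps P = qpow (- h) * R"
  proof (rule qseries_eqI)
    fix e :: rat
    \<comment> \<open>The integers $x$ with $x^2 B/(8a') = e + h$. Both sides count elements of this set in degree $e$:
      the product through $x = 2a'k + c$ and the characters through
      $x = 2NMj + (Mr \pm Ns)$, since $2pp'j + p'br \pm pb's = Bx$.\<close>
    define S where "S = {x. of_int B * of_int (x\<^sup>2) / (8 * of_nat a') = e + h}"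
    have "finite S"
    proof (rule finite_subset)
      have "\<bar>x\<bar> \<le> \<bar>\<lfloor>(e + h) * (8 * of_nat a')\<rfloor>\<bar>" if "x \<in> S" for x
      proof -
        have "of_int (int B * x\<^sup>2) = (e + h) * (8 * of_nat a')"
          using that \<open>a' > 0\<close> by (auto simp: S_def field_simps)
        then have "\<lfloor>(e + h) * (8 * of_nat a')\<rfloor> = int B * x\<^sup>2" by (metis floor_of_int)
        moreover have "1 * x\<^sup>2 \<le> int B * x\<^sup>2" by (rule mult_right_mono) (use \<open>B > 0\<close> in auto)
        moreover have "\<bar>x\<bar> \<le> x\<^sup>2" using self_le_power[of "\<bar>x\<bar>" 2] by (cases "x = 0") auto
        ultimately show ?thesis by linarith
      qed
      then show "S \<subseteq> {-\<bar>\<lfloor>(e + h) * (8 * of_nat a')\<rfloor>\<bar>..\<bar>\<lfloor>(e + h) * (8 * of_nat a')\<rfloor>\<bar>}"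
        by (force simp: abs_le_iff)
    qed simp
    have symm: "- x \<in> S \<longleftrightarrow> x \<in> S" for x by (simp add: S_def)
    have lhs: "qcoeff (qseries_of_fps P) e = (\<Sum>k | 2 * int a' * k + int c \<in> S. alt_sign k)"
    proof -
      have S: "2 * int a' * k + int c \<in> S \<longleftrightarrow> of_nat (theta_exponent \<alpha> \<beta> k) = e" for k
      proof -
        have "4 * int (theta_exponent \<alpha> \<beta> k) = int (2 * \<alpha>) * (k * (k - 1)) + int (2 * \<beta>) * (k * (k + 1))"
          using two_theta_exponent[of \<alpha> \<beta> k] by simp
        also have "\<dots> = int B * (2 * int a' * k\<^sup>2 + 2 * int c * k)"
          unfolding two\<alpha> two\<beta> using \<open>a' > c\<close> by (simp add: of_nat_diff algebra_simps power2_eq_square)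
        finally have four: "4 * int (theta_exponent \<alpha> \<beta> k)
            = int B * (2 * int a' * k\<^sup>2 + 2 * int c * k)" .
        have "8 * int a' * int (theta_exponent \<alpha> \<beta> k) + int B * (int c)\<^sup>2
            = 2 * int a' * (4 * int (theta_exponent \<alpha> \<beta> k)) + int B * (int c)\<^sup>2" by simp
        also have "\<dots> = int B * (2 * int a' * k + int c)\<^sup>2"
          unfolding four by (simp add: algebra_simps power2_eq_square)
        finally have "rat_of_int (8 * int a' * int (theta_exponent \<alpha> \<beta> k) + int B * (int c)\<^sup>2)
            = rat_of_int (int B * (2 * int a' * k + int c)\<^sup>2)" by (simp only:)
        then have "of_int B * of_int ((2 * int a' * k + int c)\<^sup>2) / (8 * of_nat a')
            = rat_of_nat (theta_exponent \<alpha> \<beta> k) + h"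
          using \<open>a' > 0\<close> by (simp add: h_def field_simps)
        then show ?thesis by (simp add: S_def)
      qed
      show ?thesis
      proof (cases "e \<in> \<nat>")
        case True
        then obtain m where m: "e = of_nat m" by (auto elim: Nats_cases)
        have "fps_nth P m = (\<Sum>k | theta_exponent \<alpha> \<beta> k = m. alt_sign k)"
          unfolding P_def using jacobi_triple_product_fps[OF \<alpha> \<beta>, of m, where 'a = complex]
          by (simp only: \<alpha>\<beta>)
        then show ?thesis unfolding S by (simp add: m qcoeff_qseries_of_fps_of_nat)
      next
        case False
        then have "{k. 2 * int a' * k + int c \<in> S} = {}" unfolding S by auto
        then show ?thesis using False by (simp add: qcoeff_qseries_of_fps_eq_0)
      qed
    qed
    have \<theta>: "qcoeff (\<theta> (int B * y)) (e + h) = of_nat (card {j. 2 * int N * int M * j + y \<in> S})" for y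
    proof -
      have expo: "of_nat n * of_int ((2 * int p * int p' * j + int B * y)\<^sup>2) / of_nat d
          = (of_int B * of_int ((2 * int N * int M * j + y)\<^sup>2) / (8 * of_nat a') :: rat)" for j
      proof -
        have "2 * int p * int p' * j + int B * y = int B * (2 * int N * int M * j + y)"
          by (simp add: N M assms algebra_simps)
        then show ?thesis
          using \<open>n > 0\<close> \<open>B > 0\<close> \<open>a' > 0\<close> unfolding d by (simp add: power2_eq_square)
      qed
      have nz: "2 * int p * int p' \<noteq> 0" "d > 0" using assms by (simp_all add: d_def)
      show ?thesis
        unfolding \<theta>_def S_def mem_Collect_eq qcoeff_dilated_theta[OF \<open>n > 0\<close> nz] expo ..
    qed
    have \<Delta>: "qcoeff (\<Delta> (r, s)) (e + h)
        = of_nat (card {j. 2 * int N * int M * j + (int M * r - int N * s) \<in> S})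
          - of_nat (card {j. 2 * int N * int M * j + (int M * r + int N * s) \<in> S})" for r s
    proof -
      have "int p' * (r * int b) - int p * (s * int b') = int B * (int M * r - int N * s)"
        "int p' * (r * int b) + int p * (s * int b') = int B * (int M * r + int N * s)"
        by (simp_all add: N M assms algebra_simps)
      then show ?thesis by (simp add: \<Delta>_def minus_qseries.rep_eq \<theta>)
    qed
    have "qcoeff (qpow (- h) * R) e = qcoeff R (e + h)" by (simp add: qcoeff_qpow_mult)
    also have "\<dots> = (\<Sum>(r, s)\<in>?A1. qcoeff (\<Delta> (r, s)) (e + h)) - (\<Sum>(r, s)\<in>?A2. qcoeff (\<Delta> (r, s)) (e + h))"
      by (simp add: R_def minus_qseries.rep_eq sum_qcoeff case_prod_unfold)
    also have "\<dots> = (\<Sum>k | 2 * int a' * k + int c \<in> S. alt_sign k)"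
      unfolding \<Delta> index_set1_eq[OF \<open>b > 0\<close> \<open>b' > 0\<close> \<open>a' > 0\<close> N M]
        index_set2_eq[OF \<open>b > 0\<close> \<open>b' > 0\<close> \<open>a' > 0\<close> N M]
      by (rule signed_theta_regrouping[symmetric])
         (use \<open>coprime N M\<close> \<open>N > 0\<close> \<open>M > 0\<close> \<open>even N\<close> \<open>a' dvd M\<close> \<open>odd c\<close> c \<open>a' > c\<close> \<open>finite S\<close> symm in auto)
    finally show "qcoeff (qseries_of_fps P) e = qcoeff (qpow (- h) * R) e" by (simp only: lhs)
  qed
  have "P / qpochhammer_inf [fps_X ^ n] (fps_X ^ n) = P * (1 / qpochhammer_inf [fps_X ^ n] (fps_X ^ n))"
    using euler_product_nth_0[OF \<open>n > 0\<close>, where 'a = complex] by (simp add: fps_divide_unit)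
  then have "qseries_of_fps (P / qpochhammer_inf [fps_X ^ n] (fps_X ^ n)) = qseries_of_fps P * U"
    by (simp add: qseries_of_fps_mult U_def)
  also have "\<dots> = qpow (- h) * U * R" by (simp add: P mult_ac)
  also have "\<dots> = qpow (of_int ((int p - int p')\<^sup>2 - (int c * int B)\<^sup>2) / of_nat (8 * B * a'))
      * (qpow (- L) * U * R)"
    unfolding L[symmetric] qpow_add by (simp only: mult_ac)
  also have "qpow (- L) * U * R = (\<Sum>rs\<in>?A1. qpow (- L) * U * \<Delta> rs) - (\<Sum>rs\<in>?A2. qpow (- L) * U * \<Delta> rs)"
    by (simp add: R_def right_diff_distrib sum_distrib_left)
  finally show ?thesis
    unfolding P_def \<alpha>_def \<beta>_def char by (simp add: case_prod_unfold)
qed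

end
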